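(* Let $q$ be an odd prime, and let $n\ge 2$ be an integer. Let $A_0,A_1,\ldots,A_{n-2}$ and $B_1,\ldots,B_{n-2}$ be multiplicative characters over $\mathbb{F}_q$. Let $x,z\in\mathbb{F}_q\setminus\{0,1\}$. Then $$\begin{aligned} &{}_2F_1\left(\begin{matrix}\phi & \phi\\ & \epsilon\end{matrix}\ \middle|\ z\right)\;{}_{n+1}F_n\left(\begin{matrix}A_0 & A_1 & \cdots & A_{n-2} & \phi & \phi\\ & B_1 & \cdots & B_{n-2} & \epsilon & \epsilon\end{matrix}\ \middle|\ x\right)\\ &=\frac{\phi(-1)}{q^2}\,\phi(1-z)\;{}_{n-1}F_{n-2}\left(\begin{matrix}A_0 & A_1 & \cdots & A_{n-2}\\ & B_1 & \cdots & B_{n-2}\end{matrix}\ \middle|\ (1-z)x\right)\\ &\quad+\frac1q\;{}_{n-1}F_{n-2}\left(\begin{matrix}A_0 & A_1 & \cdots & A_{n-2}\\ & B_1 & \cdots & B_{n-2}\end{matrix}\ \middle|\ x\right)\;{}_2F_1\left(\begin{matrix}\phi & \phi\\ & \epsilon\end{matrix}\ \middle|\ 1\right)\;{}_2F_1\left(\begin{matrix}\phi & \phi\\ & \epsilon\end{matrix}\ \middle|\ z\right)\\ &\quad+\frac{1}{q^3}\sum_{w\in\mathbb{F}_q\setminus\{1\}}\phi(w)\;{}_{n-1}F_{n-2}\left(\begin{matrix}A_0 & A_1 & \cdots & A_{n-2}\\ & B_1 & \cdots & B_{n-2}\end{matrix}\ \middle|\ wx\right)\,F_4\big(\phi;\phi;\epsilon,\epsilon;z(1-w),w(1-z)\big)^*.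 \end{aligned}$$
   Context: $\mathbb{F}_q$ is the finite field with $q$ elements; $\epsilon$ and $\phi$ are the trivial and quadratic multiplicative characters of $\mathbb{F}_q$. Every multiplicative character $\chi$ (including $\epsilon$) is extended to $\mathbb{F}_q$ by $\chi(0)=0$; $\overline{\chi}$ is the inverse character. For multiplicative characters $A,B$: $J(A,B)=\sum_{x\in\mathbb{F}_q}A(x)B(1-x)$ and $\binom{A}{B}=\frac{B(-1)}{q}J(A,\overline{B})$. For $n\ge 1$, multiplicative characters $A_0,\ldots,A_n,B_1,\ldots,B_n$ and $x\in\mathbb{F}_q$, the Gaussian hypergeometric function is $${}_{n+1}F_n\left(\begin{matrix}A_0 & A_1 & \cdots & A_n\\ & B_1 & \cdots & B_n\end{matrix}\ \middle|\ x\right)=\frac{q}{q-1}\sum_{\chi}\binom{A_0\chi}{\chi}\binom{A_1\chi}{B_1\chi}\cdots\binom{A_n\chi}{B_n\chi}\chi(x),$$ the sum running over all multiplicative characters $\chi$ of $\mathbb{F}_q$; and ${}_1F_0(A\mid x)=\epsilon(x)\overline{A}(1-x)$. Gauss sums: since $q$ is prime, fix a primitive $q$-th root of unity $\zeta_q\in\mathbb{C}$, let $\theta(\alpha)=\zeta_q^{\alpha}$ for $\alpha\in\mathbb{F}_q$, and $g(\chi)=\sum_{x\in\mathbb{F}_q}\chi(x)\theta(x)$ (so $g(\epsilon)=-1$). For multiplicative characters $A,B,C,C'$ and $x,y\in\mathbb{F}_q$, the finite field Appell series is $$F_4(A;B;C,C';x,y)^*=\frac{1}{(q-1)^2}\sum_{\chi,\lambda}\frac{g(A\chi\lambda)\,g(B\chi\lambda)\,g(\overline{C\chi})\,g(\overline{C'\lambda})\,g(\overline{\lambda})\,g(\overline{\chi})}{g(A)\,g(B)\,g(\overline{C})\,g(\overline{C'})}\,\chi(x)\lambda(y),$$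 the sum being over all multiplicative characters $\chi,\lambda$ of $\mathbb{F}_q$. *)

theory Defs
  imports Complex_Main "Berlekamp_Zassenhaus.Finite_Field"
begin

text \<open>
  A multiplicative character is a complex function on the whole field, with the convention
  that \<^emph>\<open>every\<close> character, the trivial one included, vanishes at \<open>0\<close>.
\<close>

definition mult_char :: "('a::{field,finite} \<Rightarrow> complex) \<Rightarrow> bool" where
  "mult_char \<chi> \<longleftrightarrow> \<chi> 0 = 0 \<and> \<chi> 1 = 1 \<and> (\<forall>x y. \<chi> (x * y) = \<chi> x * \<chi> y)"

definition mult_chars :: "('a::{field,finite} \<Rightarrow> complex) set" where
  "mult_chars = {\<chi>. mult_char \<chi>}"

definition triv_char :: "'a::{field,finite} \<Rightarrow> complex" where
  "triv_char x = (if x = 0 then 0 else 1)"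

definition quad_char :: "'a::{field,finite} \<Rightarrow> complex" where
  "quad_char x = (if x = 0 then 0 else if \<exists>y. x = y\<^sup>2 then 1 else - 1)"

definition char_mult ::
    "('a::{field,finite} \<Rightarrow> complex) \<Rightarrow> ('a \<Rightarrow> complex) \<Rightarrow> 'a \<Rightarrow> complex" (infixl "\<odot>" 70) where
  "(\<chi> \<odot> \<psi>) x = \<chi> x * \<psi> x"

text \<open>The inverse character again vanishes at \<open>0\<close>, because \<open>inverse 0 = 0\<close>.\<close>

definition char_inv :: "('a::{field,finite} \<Rightarrow> complex) \<Rightarrow> 'a \<Rightarrow> complex" where
  "char_inv \<chi> x = inverse (\<chi> x)"

definition jacobi_sum ::
    "('a::{field,finite} \<Rightarrow> complex) \<Rightarrow> ('a \<Rightarrow> complex) \<Rightarrow> complex" where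
  "jacobi_sum A B = (\<Sum>x\<in>UNIV. A x * B (1 - x))"

definition char_binom ::
    "('a::{field,finite} \<Rightarrow> complex) \<Rightarrow> ('a \<Rightarrow> complex) \<Rightarrow> complex" where
  "char_binom A B = B (- 1) / of_nat CARD('a) * jacobi_sum A (char_inv B)"

text \<open>
  \<open>gauss_hyp A0 [A1, ..., An] [B1, ..., Bn] x\<close> is the Gaussian hypergeometric function
  with \<open>n + 1\<close> upper and \<open>n\<close> lower parameters; it is meant for lists of equal length.
  With empty lists it is the function with the single parameter \<open>A0\<close>, which is given by
  its own closed formula and not by the character sum.
\<close>

definition gauss_hyp ::
    "('a::{field,finite} \<Rightarrow> complex) \<Rightarrow> ('a \<Rightarrow> complex) list \<Rightarrow> ('a \<Rightarrow> complex) list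
      \<Rightarrow> 'a \<Rightarrow> complex" where
  "gauss_hyp A0 As Bs x =
    (if As = [] then triv_char x * char_inv A0 (1 - x)
     else of_nat CARD('a) / (of_nat CARD('a) - 1) *
       (\<Sum>\<chi>\<in>mult_chars. char_binom (A0 \<odot> \<chi>) \<chi> *
          (\<Prod>i<length As. char_binom (As ! i \<odot> \<chi>) (Bs ! i \<odot> \<chi>)) * \<chi> x))"

definition primitive_root_of_unity :: "nat \<Rightarrow> complex \<Rightarrow> bool" where
  "primitive_root_of_unity n \<zeta> \<longleftrightarrow> n > 0 \<and> \<zeta> ^ n = 1 \<and> (\<forall>k. 0 < k \<and> k < n \<longrightarrow> \<zeta> ^ k \<noteq> 1)"

text \<open>
  Over the prime field \<^typ>\<open>'p::prime_card mod_ring\<close> the additive character is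
  \<open>\<alpha> \<mapsto> \<zeta> ^ \<alpha>\<close>, where \<open>\<alpha>\<close> is represented by its residue in \<open>{0..<q}\<close>.
\<close>

definition add_char :: "complex \<Rightarrow> 'p::prime_card mod_ring \<Rightarrow> complex" where
  "add_char \<zeta> \<alpha> = \<zeta> powi to_int_mod_ring \<alpha>"

definition gauss_sum :: "complex \<Rightarrow> ('p::prime_card mod_ring \<Rightarrow> complex) \<Rightarrow> complex" where
  "gauss_sum \<zeta> \<chi> = (\<Sum>x\<in>UNIV. \<chi> x * add_char \<zeta> x)"

definition appell_F4 ::
    "complex \<Rightarrow> ('p::prime_card mod_ring \<Rightarrow> complex) \<Rightarrow> ('p mod_ring \<Rightarrow> complex)
      \<Rightarrow> ('p mod_ring \<Rightarrow> complex) \<Rightarrow> ('p mod_ring \<Rightarrow> complex)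
      \<Rightarrow> 'p mod_ring \<Rightarrow> 'p mod_ring \<Rightarrow> complex" where
  "appell_F4 \<zeta> A B C C' x y =
    1 / (of_nat CARD('p) - 1)\<^sup>2 *
    (\<Sum>\<chi>\<in>mult_chars. \<Sum>\<psi>\<in>mult_chars.
       gauss_sum \<zeta> (A \<odot> \<chi> \<odot> \<psi>) * gauss_sum \<zeta> (B \<odot> \<chi> \<odot> \<psi>) *
       gauss_sum \<zeta> (char_inv (C \<odot> \<chi>)) * gauss_sum \<zeta> (char_inv (C' \<odot> \<psi>)) *
       gauss_sum \<zeta> (char_inv \<psi>) * gauss_sum \<zeta> (char_inv \<chi>) /
       (gauss_sum \<zeta> A * gauss_sum \<zeta> B * gauss_sum \<zeta> (char_inv C) * gauss_sum \<zeta> (char_inv C'))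
       * \<chi> x * \<psi> y)"

text \<open>The sums over all multiplicative characters are sums over a finite set.\<close>

lemma finite_mult_chars: "finite (mult_chars :: ('a::{field,finite} \<Rightarrow> complex) set)"
proof -
  define m where "m = (fact CARD('a) :: nat)"
  have m: "m > 0" by (simp add: m_def)
  have pow: "\<chi> (x ^ k) = \<chi> x ^ k" if "mult_char \<chi>" for \<chi> :: "'a \<Rightarrow> complex" and x k
    using that by (induction k) (auto simp: mult_char_def)
  have root: "x ^ m = 1" if "x \<noteq> 0" for x :: 'a
  proof -
    have "\<not> inj_on (\<lambda>k. x ^ k) {..CARD('a)}"
      using card_inj_on_le[of "\<lambda>k. x ^ k" "{..CARD('a)}" UNIV] by auto
    then obtain i j where ij: "i \<noteq> j" "i \<le> CARD('a)" "j \<le> CARD('a)" "x ^ i = x ^ j"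
      by (auto simp: inj_on_def)
    have *: "x ^ m = 1" if "i < j" "j \<le> CARD('a)" "x ^ i = x ^ j" for i j
    proof -
      have "x ^ i * x ^ (j - i) = x ^ i * 1"
        using that by (metis le_add_diff_inverse less_imp_le mult_1_right power_add)
      hence "x ^ (j - i) = 1" using \<open>x \<noteq> 0\<close> by simp
      moreover have "(j - i) dvd m"
        unfolding m_def using that by (intro dvd_fact) auto
      ultimately show ?thesis by (metis dvdE power_mult power_one)
    qed
    from ij show ?thesis using *[of i j] *[of j i] by (cases "i < j") auto
  qed
  define R where "R = insert 0 {z::complex. z ^ m = 1}"
  have "finite R" unfolding R_def using finite_roots_unity[of m] m by auto
  have "mult_chars \<subseteq> {\<chi>::'a \<Rightarrow> complex. range \<chi> \<subseteq> R}"
  proof (intro subsetI CollectI, elim rangeE, simp)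
    fix \<chi> :: "'a \<Rightarrow> complex" and x
    assume "\<chi> \<in> mult_chars"
    hence c: "mult_char \<chi>" by (simp add: mult_chars_def)
    show "\<chi> x \<in> R"
    proof (cases "x = 0")
      case False
      have "\<chi> x ^ m = \<chi> 1" using pow[OF c, of x m] root[OF False] by simp
      thus ?thesis using c by (simp add: R_def mult_char_def)
    qed (use c in \<open>auto simp: R_def mult_char_def\<close>)
  qed
  moreover have "finite {\<chi>::'a \<Rightarrow> complex. range \<chi> \<subseteq> R}"
    using finite_set_of_finite_funs[of "UNIV :: 'a set" R 0] \<open>finite R\<close>
    by (simp add: image_subset_iff)
  ultimately show ?thesis by (rule finite_subset)
qed

end

theory Submission
  imports Defs
begin

text \<open>
  Write \<open>G(y)\<close> for the \<open>(n-1)\<close>-parameter function of the statement and \<open>P\<close> for the function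
  \<open>2F1(\<phi>, \<phi>; \<epsilon>)\<close>. Since \<open>q binom(\<phi>\<chi>, \<chi>)\<^sup>2 = \<Sum>w. \<phi>\<chi>(w) P(w)\<close>, the left-hand side equals
  \<open>(1/q) \<Sum>w. \<phi>(w) G(w x) P(z) P(w)\<close>. The term \<open>w = 1\<close> is the second summand of the claim; the others
  come from an analogue of Bailey's factorization of \<open>F4\<close>: for \<open>z, w\<close> different from \<open>0\<close> and \<open>1\<close>,
  \<open>P(z) P(w)\<close> is \<open>(1/q\<^sup>2) F4(z(1-w), w(1-z))\<close>, plus \<open>\<phi>(-1)/q\<close> if \<open>w = 1 - z\<close>. Here \<open>P(z) = \<phi>(-1) L(z)/q\<close> for
  the Legendre sum \<open>L(z) = \<Sum>s. \<phi>(s(s-1)(s-z))\<close>, while eliminating the Gauss sums by orthogonality turns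
  \<open>F4(a, b)\<close> into the sum of \<open>\<phi>(uv(1+u+v)(uv+av+bu))\<close> over the \<open>(u, v)\<close>-plane, and a pencil of lines
  identifies this double sum with \<open>L(z) L(w)\<close>, up to the exceptional term.
\<close>

section \<open>Multiplicative characters\<close>

definition cyclic_generator :: "'a::{field,finite} \<Rightarrow> bool" where
  "cyclic_generator g \<longleftrightarrow> g \<noteq> 0 \<and> (\<forall>x. x \<noteq> 0 \<longrightarrow> (\<exists>k::nat. x = g ^ k))"

text \<open>The type class field is repackaged as a record with carrier \<open>UNIV\<close>, so that
  the algebraic theorem on cyclicity of the multiplicative group of a finite field applies to
  it.\<close>

lemma ex_cyclic_generator: "\<exists>g::'a::{field,finite}. cyclic_generator g"
proof -
  define R :: "'a ring" where
    "R = \<lparr>carrier = UNIV, monoid.mult = (*), one = 1, ring.zero = 0, add = (+)\<rparr>"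
  have "\<exists>y. x + y = 0" for x :: 'a
    by (rule exI[of _ "- x"]) simp
  moreover have "x \<noteq> 0 \<Longrightarrow> \<exists>y. x * y = 1" for x :: 'a
    by (rule exI[of _ "inverse x"]) simp
  ultimately interpret R: field R
    unfolding R_def using add.right_inverse
    by unfold_locales (auto simp: algebra_simps Units_def)
  have "finite (carrier R)" by simp
  then obtain g where g: "g \<in> carrier (mult_of R)"
    "carrier (mult_of R) = {g [^]\<^bsub>R\<^esub> i | i::nat. i \<in> UNIV}"
    using R.finite_field_mult_group_has_gen by blast
  have pow: "g [^]\<^bsub>R\<^esub> i = g ^ i" for i :: nat
  proof (induction i)
    case (Suc i)
    thus ?case by (simp add: R_def mult.commute)
  qed (simp add: R_def)
  have car: "carrier (mult_of R) = UNIV - {0}"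
    by (simp add: R_def)
  have "x \<in> range (\<lambda>i. g ^ i)" if "x \<noteq> 0" for x
  proof -
    have "x \<in> carrier (mult_of R)" using car that by simp
    thus ?thesis unfolding g(2) pow by blast
  qed
  moreover have "g \<noteq> 0" using g(1) unfolding car by simp
  ultimately show ?thesis unfolding cyclic_generator_def by blast
qed

lemma power_mod_exponent:
  fixes c :: "'a::comm_monoid_mult"
  assumes "c ^ d = 1"
  shows "c ^ (k mod d) = c ^ k"
proof -
  have "c ^ k = (c ^ d) ^ (k div d) * c ^ (k mod d)"
    unfolding power_mult[symmetric] power_add[symmetric] by simp
  with assms show ?thesis by simp
qed

lemma card_field_ge_2: "CARD('a::{field,finite}) \<ge> 2"
  using card_mono[of UNIV "{0, 1 :: 'a}"] by simp

context
  fixes g :: "'a::{field,finite}"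
  assumes g: "cyclic_generator g"
begin

lemma cyclic_generator_diff:
  assumes "i \<le> j" "g ^ i = g ^ j"
  shows "g ^ (j - i) = 1"
proof -
  have "g ^ i * g ^ (j - i) = g ^ i * 1" using assms by (metis le_add_diff_inverse mult_1_right power_add)
  with g show ?thesis by (simp add: cyclic_generator_def)
qed

text \<open>If \<open>g ^ d = 1\<close>, exponents may be reduced modulo \<open>d\<close>, so at
  most \<open>d\<close> powers have to cover all nonzero elements.\<close>

lemma cyclic_generator_order_ge:
  assumes "d > 0" "g ^ d = 1"
  shows "CARD('a) - 1 \<le> d"
proof -
  have "- {0} \<subseteq> (\<lambda>k. g ^ k) ` {..<d}"
  proof
    fix x :: 'a assume "x \<in> - {0}"
    then obtain k where "x = g ^ k" using g by (auto simp: cyclic_generator_def)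
    hence "x = g ^ (k mod d)" using power_mod_exponent assms by metis
    thus "x \<in> (\<lambda>k. g ^ k) ` {..<d}" using assms by auto
  qed
  from card_mono[OF _ this] have "card (- {0::'a}) \<le> card ((\<lambda>k. g ^ k) ` {..<d})" by simp
  also have "\<dots> \<le> card {..<d}" by (rule card_image_le) simp
  finally show ?thesis by (simp add: Compl_eq_Diff_UNIV card_Diff_singleton)
qed

text \<open>By pigeonhole two of the exponents \<open>0..m\<close> give the same power. Their
  difference is a period of at most \<open>m\<close>, and the preceding lower bound forces it to
  equal \<open>m\<close>.\<close>

lemma cyclic_generator_power_card: "g ^ (CARD('a) - 1) = 1"
proof -
  define m where "m = CARD('a) - 1"
  have m: "card (- {0 :: 'a}) = m" by (simp add: m_def Compl_eq_Diff_UNIV card_Diff_singleton)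
  have "\<not> inj_on (\<lambda>k. g ^ k) {..m}"
  proof
    assume "inj_on (\<lambda>k. g ^ k) {..m}"
    moreover have "(\<lambda>k. g ^ k) ` {..m} \<subseteq> - {0}"
      using g by (auto simp: cyclic_generator_def)
    ultimately show False
      using card_inj_on_le[of "\<lambda>k. g ^ k" "{..m}" "- {0}"] m by simp
  qed
  then obtain i j where ij: "i < j" "j \<le> m" "g ^ i = g ^ j"
    unfolding inj_on_def by (metis atMost_iff linorder_neqE_nat)
  have "g ^ (j - i) = 1" using cyclic_generator_diff ij by simp
  moreover from this have "m \<le> j - i" using cyclic_generator_order_ge[of "j - i"] ij
    by (simp add: m_def)
  hence "j - i = m" using ij by simp
  ultimately show ?thesis by (simp add: m_def)
qed

text \<open>This makes the assignment of \<open>c ^ k\<close> to \<open>g ^ k\<close> well defined,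
  which is what constructing characters from roots of unity requires.\<close>

lemma cyclic_generator_power_cong:
  fixes c :: complex
  assumes "g ^ i = g ^ j" "c ^ (CARD('a) - 1) = 1"
  shows "c ^ i = c ^ j"
proof -
  define m where "m = CARD('a) - 1"
  have "m > 0" using card_field_ge_2[where 'a='a] by (simp add: m_def)
  have *: "c ^ i = c ^ j" if "i \<le> j" "g ^ i = g ^ j" for i j
  proof -
    have "g ^ ((j - i) mod m) = 1"
      using power_mod_exponent[OF cyclic_generator_power_card] cyclic_generator_diff that
      by (simp add: m_def)
    hence "(j - i) mod m = 0"
      using cyclic_generator_order_ge[of "(j - i) mod m"] mod_less_divisor[OF \<open>m > 0\<close>, of "j - i"]
      by (auto simp: m_def simp del: mod_less_divisor)
    hence "c ^ (j - i) = 1"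
      using power_mod_exponent[of c m "j - i"] assms by (simp add: m_def)
    thus ?thesis using that by (metis le_add_diff_inverse mult.right_neutral power_add)
  qed
  show ?thesis using * assms(1) by (metis nat_le_linear)
qed

end

section \<open>Characters: basic rules, existence and orthogonality\<close>

context
  fixes \<chi> :: "'a::{field,finite} \<Rightarrow> complex"
  assumes \<chi>: "mult_char \<chi>"
begin

lemma mult_char_0: "\<chi> 0 = 0" and mult_char_1: "\<chi> 1 = 1" and mult_char_mult: "\<chi> (x * y) = \<chi> x * \<chi> y"
  using \<chi> unfolding mult_char_def by blast+

lemma mult_char_eq_0_iff: "\<chi> x = 0 \<longleftrightarrow> x = 0"
proof
  assume "\<chi> x = 0"
  thus "x = 0" using mult_char_mult[of x "inverse x"] mult_char_0 mult_char_1 by (cases "x = 0") auto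
qed (simp add: mult_char_0)

lemma mult_char_inverse: "\<chi> (inverse x) = inverse (\<chi> x)"
proof (cases "x = 0")
  case False
  hence "\<chi> x * \<chi> (inverse x) = 1" using mult_char_mult[of x "inverse x"] mult_char_1 by simp
  thus ?thesis by (metis inverse_unique)
qed (simp add: mult_char_0)

lemma mult_char_divide: "\<chi> (x / y) = \<chi> x / \<chi> y"
  by (simp add: divide_inverse mult_char_mult mult_char_inverse)

lemma mult_char_power: "\<chi> (x ^ k) = \<chi> x ^ k"
  by (induction k) (simp_all add: mult_char_1 mult_char_mult)

lemma char_inv_eq: "char_inv \<chi> x = \<chi> (inverse x)"
  by (simp add: char_inv_def mult_char_inverse)

end

lemma mult_char_char_inv: "mult_char \<chi> \<Longrightarrow> mult_char (char_inv \<chi>)"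
  by (simp add: mult_char_def char_inv_def)

lemma mult_char_char_mult: "mult_char \<chi> \<Longrightarrow> mult_char \<psi> \<Longrightarrow> mult_char (\<chi> \<odot> \<psi>)"
  by (simp add: mult_char_def char_mult_def)

lemma char_mult_triv_left: "mult_char \<chi> \<Longrightarrow> triv_char \<odot> \<chi> = \<chi>"
  by (auto simp: fun_eq_iff char_mult_def triv_char_def mult_char_0)

text \<open>The character is defined through an arbitrarily chosen discrete logarithm; the choice is
  immaterial by \<open>cyclic_generator_power_cong\<close>.\<close>

lemma ex_mult_char_on_powers:
  fixes g :: "'a::{field,finite}" and c :: complex
  assumes g: "cyclic_generator g" and c: "c ^ (CARD('a) - 1) = 1"
  shows "\<exists>\<chi>. mult_char \<chi> \<and> (\<forall>k. \<chi> (g ^ k) = c ^ k)"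
proof -
  define \<chi> where "\<chi> x = (if x = 0 then 0 else c ^ (SOME k. x = g ^ k))" for x
  have pow: "\<chi> (g ^ k) = c ^ k" for k
  proof -
    have "g ^ k = g ^ (SOME j. g ^ k = g ^ j)" by (rule someI[of "\<lambda>j. g ^ k = g ^ j"]) simp
    hence "c ^ k = c ^ (SOME j. g ^ k = g ^ j)" by (rule cyclic_generator_power_cong[OF g _ c])
    thus ?thesis using g by (simp add: \<chi>_def cyclic_generator_def)
  qed
  have "\<chi> (x * y) = \<chi> x * \<chi> y" for x y
  proof (cases "x = 0 \<or> y = 0")
    case False
    then obtain i j where "x = g ^ i" "y = g ^ j" using g unfolding cyclic_generator_def by blast
    thus ?thesis using pow by (simp flip: power_add)
  qed (auto simp: \<chi>_def)
  hence "mult_char \<chi>" using pow[of 0] by (simp add: mult_char_def \<chi>_def)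
  with pow show ?thesis by blast
qed

text \<open>Evaluation at a generator is a bijection from the characters to the complex roots of
  unity of order dividing \<open>CARD('a) - 1\<close>.\<close>

lemma card_mult_chars:
  "card (mult_chars :: ('a::{field,finite} \<Rightarrow> complex) set) = CARD('a) - 1"
proof -
  obtain g :: 'a where g: "cyclic_generator g"
    using ex_cyclic_generator by blast
  have "bij_betw (\<lambda>\<chi>. \<chi> g) mult_chars {c::complex. c ^ (CARD('a) - 1) = 1}"
    unfolding bij_betw_def
  proof (intro conjI inj_onI equalityI subsetI)
    fix \<chi> \<psi> :: "'a \<Rightarrow> complex"
    assume *: "\<chi> \<in> mult_chars" "\<psi> \<in> mult_chars" "\<chi> g = \<psi> g"
    show "\<chi> = \<psi>"
    proof
      fix x show "\<chi> x = \<psi> x"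
      proof (cases "x = 0")
        case False
        then obtain k where "x = g ^ k" using g unfolding cyclic_generator_def by blast
        with * show ?thesis by (simp add: mult_chars_def mult_char_power)
      qed (use * in \<open>simp add: mult_chars_def mult_char_0\<close>)
    qed
  next
    fix c :: complex assume "c \<in> (\<lambda>\<chi>. \<chi> g) ` mult_chars"
    then obtain \<chi> where "c = \<chi> g" "mult_char \<chi>" by (auto simp: mult_chars_def)
    thus "c \<in> {c. c ^ (CARD('a) - 1) = 1}"
      using cyclic_generator_power_card[OF g] mult_char_power[of \<chi> g "CARD('a) - 1"] by (simp add: mult_char_1)
  next
    fix c :: complex assume "c \<in> {c. c ^ (CARD('a) - 1) = 1}"
    then obtain \<chi> where "mult_char \<chi>" "\<forall>k. \<chi> (g ^ k) = c ^ k"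
      using ex_mult_char_on_powers[of g c] g by auto
    hence "\<chi> \<in> mult_chars" "c = \<chi> g"
      using spec[of "\<lambda>k. \<chi> (g ^ k) = c ^ k" 1] by (simp_all add: mult_chars_def)
    thus "c \<in> (\<lambda>\<chi>. \<chi> g) ` mult_chars" by blast
  qed
  moreover have "CARD('a) - 1 > 0"
    using card_field_ge_2[where 'a='a] by simp
  ultimately show ?thesis using card_roots_unity_eq[of "CARD('a) - 1"] by (simp add: bij_betw_same_card)
qed

text \<open>Sending a generator to a primitive root of unity of order \<open>m\<close> gives a
  faithful character: the value 1 at \<open>g ^ k\<close> forces \<open>m\<close> to divide
  \<open>k\<close>.\<close>

lemma ex_mult_char_neq_1:
  fixes x :: "'a::{field,finite}"
  assumes "x \<noteq> 0" "x \<noteq> 1"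
  shows "\<exists>\<chi>. mult_char \<chi> \<and> \<chi> x \<noteq> 1"
proof -
  obtain g :: 'a where g: "cyclic_generator g"
    using ex_cyclic_generator by blast
  define m where "m = CARD('a) - 1"
  define c where "c = cis (2 * pi / m)"
  have m: "m > 0" using card_field_ge_2[where 'a='a] by (simp add: m_def)
  have cpow: "c ^ k = cis (2 * pi * k / m)" for k
    by (simp add: c_def DeMoivre mult.commute)
  have "c ^ m = 1" using m by (simp add: cpow)
  then obtain \<chi> where \<chi>: "mult_char \<chi>" "\<forall>k. \<chi> (g ^ k) = c ^ k"
    using ex_mult_char_on_powers[of g c] g m_def by auto
  obtain k where k: "x = g ^ k" using g assms unfolding cyclic_generator_def by blast
  have "\<chi> x \<noteq> 1"
  proof
    assume "\<chi> x = 1"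
    hence "cis (2 * pi * k / m) = 1" using \<chi> k cpow by simp
    hence "cos (2 * pi * k / m) = 1" by (simp add: complex_eq_iff)
    then obtain i :: int where "2 * pi * k / m = of_int i * 2 * pi"
      using cos_one_2pi_int[of "2 * pi * k / m"] by (auto simp: mult_ac)
    hence "real k = of_int i * m" using m by (simp add: field_simps)
    hence "int k = i * int m" by (metis of_int_eq_iff of_int_mult of_int_of_nat_eq)
    hence "m dvd k" by (metis dvd_triv_right int_dvd_int_iff)
    then obtain j where "k = m * j" by blast
    hence "x = 1" using k cyclic_generator_power_card[OF g] by (simp add: m_def power_mult)
    with assms show False by simp
  qed
  with \<chi> show ?thesis by blast
qed

text \<open>For \<open>x\<close> different from 0 and 1, multiplication by a character \<psi> with
  \<open>\<psi> x \<noteq> 1\<close> permutes all characters, so the sum equals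
  \<open>\<psi> x\<close> times itself.\<close>

lemma sum_mult_chars:
  fixes x :: "'a::{field,finite}"
  shows "(\<Sum>\<chi>\<in>mult_chars. \<chi> x) = (if x = 1 then of_nat CARD('a) - 1 else 0)"
proof -
  consider "x = 0" | "x = 1" | "x \<noteq> 0" "x \<noteq> 1" by blast
  thus ?thesis
  proof cases
    case 1
    thus ?thesis by (simp add: mult_chars_def mult_char_0)
  next
    case 2
    have "(\<Sum>\<chi>\<in>mult_chars. \<chi> x) = (\<Sum>\<chi>\<in>(mult_chars :: ('a \<Rightarrow> complex) set). 1)"
      using 2 by (intro sum.cong) (auto simp: mult_chars_def mult_char_1)
    also have "\<dots> = of_nat CARD('a) - 1"
      using zero_less_card_finite[where 'a='a] by (simp add: card_mult_chars of_nat_diff Suc_leI)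
    finally show ?thesis using 2 by simp
  next
    case 3
    then obtain \<psi> where \<psi>: "mult_char \<psi>" "\<psi> x \<noteq> 1" using ex_mult_char_neq_1 by blast
    have "char_inv \<psi> \<odot> (\<psi> \<odot> \<chi>) = \<chi>" "\<psi> \<odot> (char_inv \<psi> \<odot> \<chi>) = \<chi>" if "mult_char \<chi>" for \<chi>
    proof -
      have "char_inv \<psi> y * (\<psi> y * \<chi> y) = \<chi> y" for y
        using \<psi> that by (cases "y = 0") (simp_all add: char_inv_def mult_char_0 mult_char_eq_0_iff)
      thus "char_inv \<psi> \<odot> (\<psi> \<odot> \<chi>) = \<chi>" "\<psi> \<odot> (char_inv \<psi> \<odot> \<chi>) = \<chi>"
        by (simp_all add: fun_eq_iff char_mult_def mult.left_commute)
    qed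
    hence "(\<Sum>\<chi>\<in>mult_chars. \<chi> x) = (\<Sum>\<chi>\<in>mult_chars. (\<psi> \<odot> \<chi>) x)"
      using \<psi> by (intro sum.reindex_bij_witness[of _ "\<lambda>\<chi>. \<psi> \<odot> \<chi>" "\<lambda>\<chi>. char_inv \<psi> \<odot> \<chi>"])
        (auto simp: mult_chars_def mult_char_char_mult mult_char_char_inv)
    also have "\<dots> = \<psi> x * (\<Sum>\<chi>\<in>mult_chars. \<chi> x)"
      by (simp add: char_mult_def sum_distrib_left)
    finally show ?thesis using \<psi> 3 by simp
  qed
qed

text \<open>The convolution theorem for the Mellin transform on the multiplicative group:
  orthogonality keeps only the pairs with \<open>u * v = x\<close>. It evaluates the function
  \<open>2F1\<close> and both character sums in \<open>F4\<close>.\<close>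

lemma sum_mult_chars_product:
  fixes f h :: "'a::{field,finite} \<Rightarrow> complex"
  assumes "x \<noteq> 0"
  shows "(\<Sum>\<chi>\<in>mult_chars. (\<Sum>u\<in>UNIV. char_inv \<chi> u * f u) * (\<Sum>u\<in>UNIV. char_inv \<chi> u * h u) * \<chi> x)
    = (of_nat CARD('a) - 1) * (\<Sum>u\<in>UNIV - {0}. f u * h (x / u))"
proof -
  have "(\<Sum>\<chi>\<in>mult_chars. (\<Sum>u\<in>UNIV. char_inv \<chi> u * f u) * (\<Sum>u\<in>UNIV. char_inv \<chi> u * h u) * \<chi> x)
    = (\<Sum>\<chi>\<in>mult_chars. \<Sum>u\<in>UNIV. \<Sum>v\<in>UNIV. f u * h v * \<chi> (x / (u * v)))"
    unfolding sum_product unfolding sum_distrib_right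
    by (intro sum.cong refl)
       (simp add: mult_chars_def mult_char_divide mult_char_mult mult_char_inverse char_inv_def divide_inverse mult_ac)
  also have "\<dots> = (\<Sum>u\<in>UNIV. \<Sum>v\<in>UNIV. f u * h v * (\<Sum>\<chi>\<in>mult_chars. \<chi> (x / (u * v))))"
    by (subst sum.swap, intro sum.cong refl, subst sum.swap) (simp add: sum_distrib_left)
  also have "\<dots> = (\<Sum>u\<in>UNIV. \<Sum>v\<in>UNIV. if u \<noteq> 0 \<and> v = x / u then f u * h v * (of_nat CARD('a) - 1) else 0)"
    unfolding sum_mult_chars using assms by (intro sum.cong refl) (auto simp: field_simps)
  also have "\<dots> = (\<Sum>u\<in>UNIV. if u \<noteq> 0 then f u * h (x / u) * (of_nat CARD('a) - 1) else 0)"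
    by (intro sum.cong refl) auto
  also have "\<dots> = (\<Sum>u\<in>UNIV - {0}. f u * h (x / u) * (of_nat CARD('a) - 1))"
    by (intro sum.mono_neutral_cong_right) auto
  finally show ?thesis by (simp add: sum_distrib_left mult_ac)
qed

section \<open>The quadratic character and Legendre sums\<close>

lemma quad_char_0 [simp]: "quad_char 0 = 0"
  by (simp add: quad_char_def)

lemma quad_char_square [simp]: "x \<noteq> 0 \<Longrightarrow> quad_char (x\<^sup>2) = 1"
  by (auto simp: quad_char_def)

lemma quad_char_square_self: "x \<noteq> 0 \<Longrightarrow> quad_char x * quad_char x = 1"
  by (simp add: quad_char_def)

lemma char_inv_triv_char [simp]: "char_inv triv_char = triv_char"
  by (simp add: fun_eq_iff char_inv_def triv_char_def)

text \<open>For odd cardinality, -1 is a root of unity of order dividing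
  \<open>CARD('a) - 1\<close>, so the parity of an exponent depends only on the power, and the
  squares are exactly the even powers.\<close>

lemma quad_char_on_powers:
  fixes g :: "'a::{field,finite}"
  assumes g: "cyclic_generator g" and odd: "odd CARD('a)"
  shows "quad_char (g ^ k) = (- 1) ^ k"
proof -
  have m1: "(- 1 :: complex) ^ (CARD('a) - 1) = 1" using odd by simp
  have g0: "g ^ k \<noteq> 0" for k using g by (simp add: cyclic_generator_def)
  have "(\<exists>y. g ^ k = y\<^sup>2) \<longleftrightarrow> even k"
  proof
    assume "\<exists>y. g ^ k = y\<^sup>2"
    then obtain y where y: "g ^ k = y\<^sup>2" by blast
    with g0[of k] have "y \<noteq> 0" by auto
    then obtain j where "y = g ^ j" using g unfolding cyclic_generator_def by blast
    with y have "g ^ k = g ^ (2 * j)" by (simp add: power_mult power2_eq_square power_add mult_2)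
    from cyclic_generator_power_cong[OF g this m1] have "(- 1 :: complex) ^ k = 1" by simp
    thus "even k" by (cases "even k") simp_all
  next
    assume "even k"
    then obtain j where "k = j * 2" by (metis evenE mult.commute)
    hence "g ^ k = (g ^ j)\<^sup>2" by (simp add: power_mult)
    thus "\<exists>y. g ^ k = y\<^sup>2" by blast
  qed
  thus ?thesis using g0 by (cases "even k") (auto simp: quad_char_def)
qed

lemma mult_char_quad_char:
  assumes odd: "odd CARD('a::{field,finite})"
  shows "mult_char (quad_char :: 'a \<Rightarrow> complex)"
proof -
  obtain g :: 'a where g: "cyclic_generator g" using ex_cyclic_generator by blast
  have "quad_char (x * y) = quad_char x * quad_char y" for x y :: 'a
  proof (cases "x = 0 \<or> y = 0")
    case False
    then obtain i j where "x = g ^ i" "y = g ^ j" using g unfolding cyclic_generator_def by blast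
    thus ?thesis using quad_char_on_powers[OF g odd]
      by (simp flip: power_add)
  qed auto
  moreover have "quad_char (1::'a) = 1"
    using quad_char_on_powers[OF g odd, of 0] by simp
  ultimately show ?thesis by (simp add: mult_char_def)
qed

section \<open>Quadratic character sums of polynomials of degree at most two\<close>

context
  assumes odd: "odd CARD('a::{field,finite})"
begin

lemma quad_char_mult: "quad_char (x * y :: 'a) = quad_char x * quad_char y"
  using mult_char_mult[OF mult_char_quad_char[OF odd]] .

lemma quad_char_1: "quad_char (1 :: 'a) = 1"
  using mult_char_1[OF mult_char_quad_char[OF odd]] .

text \<open>Most substitutions below rest on this: the new argument differs from the old one by a
  nonzero square.\<close>

lemma quad_char_mult_square: "y \<noteq> 0 \<Longrightarrow> quad_char (x * y\<^sup>2 :: 'a) = quad_char x"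
  by (simp add: quad_char_mult)

text \<open>Multiplication by a generator, a nonsquare, permutes the field and reverses the sign of
  every term.\<close>

lemma sum_quad_char: "(\<Sum>x\<in>UNIV. quad_char (x :: 'a)) = 0"
proof -
  obtain g :: 'a where g: "cyclic_generator g" using ex_cyclic_generator by blast
  hence g0: "g \<noteq> 0" by (simp add: cyclic_generator_def)
  have "(\<Sum>x\<in>UNIV. quad_char (x :: 'a)) = (\<Sum>x\<in>UNIV. quad_char (g * x))"
    using g0 by (intro sum.reindex_bij_witness[of _ "\<lambda>x. g * x" "\<lambda>x. x / g"]) auto
  also have "\<dots> = - (\<Sum>x\<in>UNIV. quad_char (x :: 'a))"
    using quad_char_on_powers[OF g odd, of 1] by (simp add: quad_char_mult sum_negf)
  finally show ?thesis by simp
qed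

lemma sum_quad_char_affine:
  assumes "a \<noteq> 0"
  shows "(\<Sum>x\<in>UNIV. quad_char (a * x + b :: 'a)) = 0"
proof -
  have "(\<Sum>x\<in>UNIV. quad_char (a * x + b)) = (\<Sum>x\<in>UNIV. quad_char (x :: 'a))"
    using assms by (intro sum.reindex_bij_witness[of _ "\<lambda>x. (x - b) / a" "\<lambda>x. a * x + b"]) auto
  thus ?thesis by (simp add: sum_quad_char)
qed

text \<open>A translation moves one root to 0; inverting the variable and dropping a square then
  leaves an affine polynomial. For distinct roots its full sum vanishes, and -1 accounts for the
  missing point 0.\<close>

lemma sum_quad_char_quadratic:
  shows "(\<Sum>x\<in>UNIV. quad_char ((x - a) * (x - b) :: 'a)) = (if a = b then of_nat CARD('a) - 1 else - 1)"
proof -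
  have "(\<Sum>x\<in>UNIV. quad_char ((x - a) * (x - b))) = (\<Sum>x\<in>UNIV. quad_char (x * (x + (a - b))))"
    by (intro sum.reindex_bij_witness[of _ "\<lambda>x. x + a" "\<lambda>x. x - a"]) (auto simp: algebra_simps)
  also have "\<dots> = (\<Sum>x\<in>UNIV - {0}. quad_char (x * (x + (a - b))))"
    by (intro sum.mono_neutral_right) auto
  also have "\<dots> = (\<Sum>x\<in>UNIV - {0}. quad_char (1 + (a - b) * x))"
  proof (intro sum.reindex_bij_witness[of _ inverse inverse])
    fix x :: 'a assume x: "x \<in> UNIV - {0}"
    hence "x * (x + (a - b)) = (1 + (a - b) * inverse x) * x\<^sup>2"
      by (simp add: field_simps power2_eq_square)
    thus "quad_char (1 + (a - b) * inverse x) = quad_char (x * (x + (a - b)))"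
      using x quad_char_mult_square by simp
  qed auto
  also have "\<dots> = (if a = b then of_nat CARD('a) - 1 else - 1)"
  proof (cases "a = b")
    case True
    have "CARD('a) \<ge> 1" using card_field_ge_2[where 'a='a] by simp
    with True show ?thesis by (simp add: quad_char_1 card_Diff_singleton of_nat_diff)
  next
    case False
    have "(\<Sum>x\<in>UNIV - {0}. quad_char (1 + (a - b) * x)) =
      (\<Sum>x\<in>UNIV. quad_char ((a - b) * x + 1)) - 1"
      by (simp add: sum_diff1 quad_char_1 add.commute)
    with False show ?thesis using sum_quad_char_affine[of "a - b" 1] by simp
  qed
  finally show ?thesis .
qed

end

text \<open>In odd characteristic and for \<open>z\<close> different from 0 and 1, this is minus the
  trace of Frobenius of the Legendre curve \<open>y^2 = s (s - 1) (s - z)\<close>.\<close>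

definition legendre_sum :: "'a::{field,finite} \<Rightarrow> complex" where
  "legendre_sum z = (\<Sum>s\<in>UNIV. quad_char (s * (s - 1) * (s - z)))"

context
  assumes odd: "odd CARD('a::{field,finite})"
begin

text \<open>Replacing \<open>s\<close> by its inverse changes the argument only by the factor
  \<open>s^4\<close>.\<close>

lemma legendre_sum_inversion:
  "(\<Sum>s\<in>UNIV. quad_char (s * (s - 1) * (s * z - 1) :: 'a)) = legendre_sum z"
proof -
  have "(\<Sum>s\<in>UNIV. quad_char (s * (s - 1) * (s * z - 1))) =
    (\<Sum>s\<in>UNIV - {0}. quad_char (s * (s - 1) * (s * z - 1)))"
    by (intro sum.mono_neutral_right) auto
  also have "\<dots> = (\<Sum>s\<in>UNIV - {0}. quad_char (s * (s - 1) * (s - z)))"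
  proof (intro sum.reindex_bij_witness[of _ inverse inverse])
    fix s :: 'a assume s: "s \<in> UNIV - {0}"
    hence "s * (s - 1) * (s * z - 1) = inverse s * (inverse s - 1) * (inverse s - z) * (s\<^sup>2)\<^sup>2"
      by (simp add: field_simps power2_eq_square)
    moreover have "s\<^sup>2 \<noteq> 0" using s by simp
    ultimately show "quad_char (inverse s * (inverse s - 1) * (inverse s - z)) = quad_char (s * (s - 1) * (s * z - 1))"
      by (metis quad_char_mult_square[OF odd])
  qed auto
  also have "\<dots> = legendre_sum z"
    unfolding legendre_sum_def by (intro sum.mono_neutral_left) auto
  finally show ?thesis .
qed

text \<open>
  The surface \<open>y\<^sup>2 = u v (1 + u + v) (u v + a v + b u)\<close>: the line \<open>1 + u + v = 0\<close> and the conic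
  \<open>u v + a v + b u = 0\<close> meet in the rational point \<open>(- z, z - 1)\<close>, and the lines through this point
  cut out a family of twists of one Legendre curve.
\<close>

lemma sum_quad_char_surface:
  fixes z w :: 'a
  assumes z: "z \<noteq> 0" "z \<noteq> 1" and w: "w \<noteq> 0" "w \<noteq> 1"
  defines "a \<equiv> z * (1 - w)" and "b \<equiv> w * (1 - z)"
  shows "(\<Sum>u\<in>UNIV. \<Sum>v\<in>UNIV. quad_char (u * v * (1 + u + v) * (u * v + a * v + b * u)))
    = legendre_sum z * legendre_sum w
      - (if w = 1 - z then of_nat CARD('a) * quad_char (- 1 :: 'a) else 0)"
proof -
  note qm = quad_char_mult[OF odd] and qsq = quad_char_mult_square[OF odd]
  define f where "f u v = quad_char (u * v * (1 + u + v) * (u * v + a * v + b * u))" for u v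
  \<comment> \<open>Put \<open>u = r - z\<close> and \<open>v = z - 1 + m * r\<close>:
    \<open>m\<close> is the slope of a line through the common point and \<open>r\<close> the
    parameter along it. Both the linear form and the conic are then divisible by \<open>r\<close>,
    and \<open>h\<close> is what remains after dropping \<open>r^2\<close>.\<close>
  define h where "h m r = quad_char ((1 + m) * (r - z) * (m * r + z - 1) *
    (m * r - z * w * m - (1 - z) * (1 - w)))" for m r
  have line: "(\<Sum>v\<in>UNIV. f (r - z) v) = (\<Sum>m\<in>UNIV. h m r)" if r: "r \<noteq> 0" for r
  proof (intro sum.reindex_bij_witness[of _ "\<lambda>m. z - 1 + m * r" "\<lambda>v. (v - (z - 1)) / r"])
    fix v
    define m where "m = (v - (z - 1)) / r"
    have v: "v = z - 1 + m * r" using r by (simp add: m_def)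
    have "1 + (r - z) + v = (1 + m) * r"
      by (simp add: v algebra_simps)
    moreover have "(r - z) * v + a * v + b * (r - z) = (m * r - z * w * m - (1 - z) * (1 - w)) * r"
      by (simp add: v a_def b_def algebra_simps)
    ultimately have eq: "(r - z) * v * (1 + (r - z) + v) * ((r - z) * v + a * v + b * (r - z))
      = (1 + m) * (r - z) * (m * r + z - 1) * (m * r - z * w * m - (1 - z) * (1 - w)) * r\<^sup>2"
      using v by (simp add: power2_eq_square ac_simps)
    show "h ((v - (z - 1)) / r) r = f (r - z) v"
      unfolding f_def h_def m_def[symmetric] eq by (rule qsq[OF r, symmetric])
  qed (use r in auto)
  \<comment> \<open>The line \<open>r = 0\<close> has no finite slope. On it the linear form and the
    conic are proportional, so up to a square the argument is \<open>w * v\<close>, except at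
    \<open>v = z - 1\<close>, where it vanishes.\<close>
  have vertical: "(\<Sum>v\<in>UNIV. f (- z) v) = - quad_char (- ((1 - z) * w))"
  proof -
    have "f (- z) v = (if v = z - 1 then 0 else quad_char (w * v + 0))" for v
    proof -
      have conic: "- z * v + a * v + b * (- z) = - (z * w * (v - (z - 1)))"
        by (simp add: a_def b_def algebra_simps)
      have "- z * v * (1 + - z + v) * (- z * v + a * v + b * (- z)) = w * v * (z * (v - (z - 1)))\<^sup>2"
        unfolding conic by (simp add: power2_eq_square)
      thus ?thesis unfolding f_def using z qsq[of "z * (v - (z - 1))" "w * v"] by auto
    qed
    hence "(\<Sum>v\<in>UNIV. f (- z) v) = (\<Sum>v\<in>UNIV. quad_char (w * v + 0) - (if v = z - 1 then quad_char (w * v) else 0))"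
      by (intro sum.cong) auto
    also have "\<dots> = - quad_char (w * (z - 1))"
      unfolding sum_subtractf using sum_quad_char_affine[OF odd w(1), of 0] by simp
    finally show ?thesis by (simp add: algebra_simps)
  qed
  \<comment> \<open>For fixed slope, \<open>h\<close> is a cubic in \<open>r\<close> with roots
    \<open>z\<close>, \<open>k\<close> and \<open>k + w * (z - k)\<close>, which an affine
    substitution moves to 1, 0 and \<open>w\<close>. In the degenerate cases \<open>m = 0\<close>
    and \<open>k = z\<close> both sides vanish.\<close>
  have fibre: "(\<Sum>r\<in>UNIV. h m r) = quad_char (m * (m + 1) * (z * m + z - 1)) * legendre_sum w" for m
  proof (cases "m = 0")
    case True
    have "h m r = quad_char ((1 - w) * r + - (1 - w) * z)" for r
    proof -
      have "(1 + m) * (r - z) * (m * r + z - 1) * (m * r - z * w * m - (1 - z) * (1 - w))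
        = ((1 - w) * r + - (1 - w) * z) * (1 - z)\<^sup>2"
        unfolding True by (simp add: algebra_simps power2_eq_square)
      thus ?thesis unfolding h_def using z qsq[of "1 - z"] by simp
    qed
    thus ?thesis using True sum_quad_char_affine[OF odd, of "1 - w"] w by simp
  next
    case m: False
    \<comment> \<open>The parameter at which the line of slope \<open>m\<close> meets the axis
      \<open>v = 0\<close>.\<close>
    define k where "k = (1 - z) / m"
    have km: "k * m = 1 - z" using m by (simp add: k_def)
    have km1: "m * r + z - 1 = m * (r - k)" for r
    proof -
      have "m * r + z - 1 = m * r - (1 - z)" by simp
      thus ?thesis unfolding km[symmetric] by (simp add: algebra_simps)
    qed
    have km2: "m * r - z * w * m - (1 - z) * (1 - w) = m * (r - k - w * (z - k))" for r
      unfolding km[symmetric] by (simp add: algebra_simps)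
    have h: "h m r = quad_char ((1 + m) * (r - z) * (r - k) * (r - k - w * (z - k)))" for r
    proof -
      have eq: "(1 + m) * (r - z) * (m * r + z - 1) * (m * r - z * w * m - (1 - z) * (1 - w))
        = (1 + m) * (r - z) * (r - k) * (r - k - w * (z - k)) * m\<^sup>2"
        unfolding km1 km2 by (simp add: power2_eq_square)
      show ?thesis unfolding h_def eq by (rule qsq[OF m])
    qed
    have tw: "quad_char (m * (m + 1) * (z * m + z - 1)) = quad_char ((1 + m) * (z - k))"
    proof -
      have "m * (m + 1) * (z * m + z - 1) = (1 + m) * (z - k) * m\<^sup>2"
        using km1[of z] by (simp add: power2_eq_square mult.commute)
      thus ?thesis using m qsq[of m] by simp
    qed
    show ?thesis
    proof (cases "k = z")
      case True
      have "h m r = quad_char ((1 + m) * r + - (1 + m) * z)" for r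
      proof (cases "r = z")
        case False
        have "(1 + m) * (r - z) * (r - k) * (r - k - w * (z - k)) = ((1 + m) * r + - (1 + m) * z) * (r - z)\<^sup>2"
          unfolding True by (simp add: algebra_simps power2_eq_square)
        thus ?thesis unfolding h using False qsq[of "r - z"] by simp
      qed (simp add: h algebra_simps)
      moreover have "1 + m \<noteq> 0"
      proof
        assume "1 + m = 0"
        hence "m = - 1" by (simp add: eq_neg_iff_add_eq_0 add.commute)
        with km True show False by simp
      qed
      ultimately show ?thesis
        using sum_quad_char_affine[OF odd, of "1 + m"] True tw by simp
    next
      case False
      have "(\<Sum>r\<in>UNIV. h m r) = (\<Sum>t\<in>UNIV. quad_char ((1 + m) * (z - k)) * quad_char (t * (t - 1) * (t - w)))"
      proof (intro sum.reindex_bij_witness[of _ "\<lambda>t. k + (z - k) * t" "\<lambda>r. (r - k) / (z - k)"])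
        fix r
        define t where "t = (r - k) / (z - k)"
        have r: "r = k + (z - k) * t" using False by (simp add: t_def)
        have factors: "r - z = (z - k) * (t - 1)" "r - k = (z - k) * t"
          by (simp_all add: r algebra_simps)
        have eq: "(1 + m) * (r - z) * (r - k) * (r - k - w * (z - k)) =
          (1 + m) * (z - k) * (t * (t - 1) * (t - w)) * (z - k)\<^sup>2"
          unfolding factors by (simp add: algebra_simps power2_eq_square)
        show "quad_char ((1 + m) * (z - k)) * quad_char ((r - k) / (z - k) * ((r - k) / (z - k) - 1) * ((r - k) / (z - k) - w)) = h m r"
          unfolding h t_def[symmetric] eq qm[symmetric] by (rule qsq[symmetric]) (use False in simp)
      qed (use False in auto)
      thus ?thesis by (simp add: tw legendre_sum_def sum_distrib_left)
    qed
  qed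
  have base: "(\<Sum>m\<in>UNIV. quad_char (m * (m + 1) * (z * m + z - 1))) = legendre_sum z"
  proof -
    have "(\<Sum>m\<in>UNIV. quad_char (m * (m + 1) * (z * m + z - 1))) = (\<Sum>s\<in>UNIV. quad_char (s * (s - 1) * (s * z - 1)))"
      by (intro sum.reindex_bij_witness[of _ "\<lambda>s. s - 1" "\<lambda>m. m + 1"]) (auto simp: algebra_simps)
    thus ?thesis by (simp add: legendre_sum_inversion)
  qed
  \<comment> \<open>The values at \<open>r = 0\<close> do not come from the surface and must be
    subtracted once the sum over \<open>r\<close> is completed. They form a quadratic sum in
    \<open>m\<close> with roots -1 and \<open>c\<close>; these coincide exactly for
    \<open>w = 1 - z\<close>, the origin of the exceptional term.\<close>
  have point: "(\<Sum>m\<in>UNIV. h m 0) = quad_char (- ((1 - z) * w)) * (if w = 1 - z then of_nat CARD('a) - 1 else - 1)"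
  proof -
    define c where "c = - ((1 - z) * (1 - w)) / (z * w)"
    have c: "c * z * w = - ((1 - z) * (1 - w))" using z w by (simp add: c_def)
    have "h m 0 = quad_char (- ((1 - z) * w)) * quad_char ((m - (- 1)) * (m - c))" for m
    proof -
      have "m * 0 - z * w * m - (1 - z) * (1 - w) = - (z * w * m) + c * z * w"
        unfolding c by simp
      also have "\<dots> = - (z * w * (m - c))" by (simp add: algebra_simps)
      finally have factor: "m * 0 - z * w * m - (1 - z) * (1 - w) = - (z * w * (m - c))" .
      have eq: "(1 + m) * (0 - z) * (m * 0 + z - 1) * (m * 0 - z * w * m - (1 - z) * (1 - w))
        = - ((1 - z) * w) * ((m - (- 1)) * (m - c)) * z\<^sup>2"
        unfolding factor by (simp add: algebra_simps power2_eq_square)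
      show ?thesis unfolding h_def eq qm[symmetric] by (rule qsq[OF z(1)])
    qed
    moreover have "- 1 = c \<longleftrightarrow> w = 1 - z"
    proof
      assume "- 1 = c"
      have "w - (1 - z) = z * w - (1 - z) * (1 - w)" by (simp add: algebra_simps)
      also have "\<dots> = 0" using c by (simp flip: \<open>- 1 = c\<close>)
      finally show "w = 1 - z" by simp
    next
      assume "w = 1 - z"
      hence "1 - z = w" "1 - w = z" by simp_all
      with c have "c * z * w = - (w * z)" by simp
      hence "c * (z * w) = - 1 * (z * w)" by (simp add: mult_ac)
      moreover have "z * w \<noteq> 0" using z w by simp
      ultimately show "- 1 = c" by (metis mult_right_cancel)
    qed
    ultimately show ?thesis
      using sum_quad_char_quadratic[OF odd, of "- 1" c] by (simp flip: sum_distrib_left)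
  qed
  \<comment> \<open>The vertical line is split off, the other lines \<open>u = r - z\<close> are
    reparametrized by slope, and the value \<open>r = 0\<close> is added and subtracted so that the
    order of summation can be exchanged.\<close>
  have "(\<Sum>u\<in>UNIV. \<Sum>v\<in>UNIV. f u v) = (\<Sum>r\<in>UNIV. \<Sum>v\<in>UNIV. f (r - z) v)"
    by (rule sum.reindex_bij_witness[of _ "\<lambda>r. r - z" "\<lambda>u. u + z"]) auto
  also have "\<dots> = (\<Sum>v\<in>UNIV. f (0 - z) v) + (\<Sum>r\<in>UNIV - {0}. \<Sum>v\<in>UNIV. f (r - z) v)"
    by (rule sum.remove) auto
  also have "(\<Sum>r\<in>UNIV - {0}. \<Sum>v\<in>UNIV. f (r - z) v) = (\<Sum>r\<in>UNIV - {0}. \<Sum>m\<in>UNIV. h m r)"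
    by (rule sum.cong[OF refl]) (use line in simp)
  also have "\<dots> = (\<Sum>r\<in>UNIV. \<Sum>m\<in>UNIV. h m r) - (\<Sum>m\<in>UNIV. h m 0)"
    by (simp add: sum_diff1)
  also have "(\<Sum>r\<in>UNIV. \<Sum>m\<in>UNIV. h m r) = (\<Sum>m\<in>UNIV. \<Sum>r\<in>UNIV. h m r)"
    by (rule sum.swap)
  also have "\<dots> = legendre_sum z * legendre_sum w"
    by (simp add: fibre base flip: sum_distrib_right)
  finally have "(\<Sum>u\<in>UNIV. \<Sum>v\<in>UNIV. f u v) = legendre_sum z * legendre_sum w
    - quad_char (- ((1 - z) * w)) - (\<Sum>m\<in>UNIV. h m 0)"
    using vertical by simp
  \<comment> \<open>The two boundary terms cancel unless the quadratic has a double root; then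
    \<open>(1 - z) * w\<close> is a square and they add up to \<open>q\<close> times the character
    value at -1.\<close>
  moreover have "quad_char (- ((1 - z) * w)) + (\<Sum>m\<in>UNIV. h m 0) =
    (if w = 1 - z then of_nat CARD('a) * quad_char (- 1 :: 'a) else 0)"
  proof (cases "w = 1 - z")
    case True
    hence "1 - z = w" by simp
    hence eq: "quad_char (- ((1 - z) * w)) = quad_char (- 1 :: 'a)"
      using qsq[OF w(1), of "- 1"] by (simp only: power2_eq_square mult_minus_left mult_1_left)
    show ?thesis unfolding point if_P[OF True] eq by (simp add: algebra_simps)
  next
    case False
    show ?thesis unfolding point if_not_P[OF False] by simp
  qed
  ultimately show ?thesis unfolding f_def[symmetric] by (simp only: diff_diff_eq)
qed

end

section \<open>Gaussian hypergeometric functions\<close>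

text \<open>The closed formula for \<open>1F0\<close> agrees with the general character sum, so
  empty parameter lists, that is \<open>n = 2\<close>, fit the uniform argument. Orthogonality
  selects the single point \<open>t = inverse (1 - y)\<close> of the Jacobi sum.\<close>

lemma gauss_hyp_single:
  assumes A: "mult_char (A :: 'a::{field,finite} \<Rightarrow> complex)"
  shows "gauss_hyp A [] [] y = of_nat CARD('a) / (of_nat CARD('a) - 1) *
    (\<Sum>\<chi>\<in>mult_chars. char_binom (A \<odot> \<chi>) \<chi> * \<chi> y)"
proof -
  define q :: complex where "q = of_nat CARD('a)"
  have q: "q \<noteq> 0" "q - 1 \<noteq> 0"
    using card_field_ge_2[where 'a='a] by (auto simp: q_def)
  have "(\<Sum>\<chi>\<in>mult_chars. char_binom (A \<odot> \<chi>) \<chi> * \<chi> y)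
    = (\<Sum>\<chi>\<in>mult_chars. \<Sum>t\<in>UNIV. A t / q * \<chi> (- 1 * t / (1 - t) * y))"
  proof (intro sum.cong refl)
    fix \<chi> :: "'a \<Rightarrow> complex" assume "\<chi> \<in> mult_chars"
    hence \<chi>: "mult_char \<chi>" by (simp add: mult_chars_def)
    show "char_binom (A \<odot> \<chi>) \<chi> * \<chi> y = (\<Sum>t\<in>UNIV. A t / q * \<chi> (- 1 * t / (1 - t) * y))"
      unfolding char_binom_def jacobi_sum_def char_mult_def char_inv_def sum_distrib_left sum_distrib_right
        mult_char_mult[OF \<chi>] mult_char_divide[OF \<chi>] q_def
      by (intro sum.cong refl) (simp add: divide_inverse mult_ac)
  qed
  also have "\<dots> = (\<Sum>t\<in>UNIV. A t / q * (\<Sum>\<chi>\<in>mult_chars. \<chi> (- 1 * t / (1 - t) * y)))"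
    by (subst sum.swap) (simp add: sum_distrib_left)
  also have "\<dots> = (\<Sum>t\<in>UNIV. if - 1 * t / (1 - t) * y = 1 then A t / q * (q - 1) else 0)"
    unfolding sum_mult_chars by (intro sum.cong refl) (simp add: q_def)
  \<comment> \<open>The case \<open>y = 1\<close> is covered because \<open>inverse 0 = 0\<close>
    and \<open>A 0 = 0\<close>; the factor \<open>triv_char y\<close> covers
    \<open>y = 0\<close>.\<close>
  also have "\<dots> = (\<Sum>t\<in>UNIV. if t = inverse (1 - y) then triv_char y * A t / q * (q - 1) else 0)"
  proof (intro sum.cong refl)
    fix t :: 'a
    consider "y = 0" | "y = 1" | "y \<noteq> 0" "y \<noteq> 1" by blast
    thus "(if - 1 * t / (1 - t) * y = 1 then A t / q * (q - 1) else 0) =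
      (if t = inverse (1 - y) then triv_char y * A t / q * (q - 1) else 0)"
    proof cases
      case 1
      thus ?thesis by (simp add: triv_char_def)
    next
      case 2
      have "- 1 * t / (1 - t) \<noteq> 1" by (cases "t = 1") (auto simp: field_simps)
      with 2 show ?thesis using A by (simp add: mult_char_0)
    next
      case 3
      have "- 1 * t / (1 - t) * y = 1 \<longleftrightarrow> t * (1 - y) = 1"
        using 3 by (cases "t = 1") (auto simp: field_simps)
      also have "\<dots> \<longleftrightarrow> t = inverse (1 - y)"
        using 3 by (auto simp: field_simps)
      finally show ?thesis using 3 by (simp add: triv_char_def)
    qed
  qed
  also have "\<dots> = triv_char y * A (inverse (1 - y)) / q * (q - 1)" by simp
  finally show ?thesis
    using q by (simp add: gauss_hyp_def char_inv_eq[OF A] q_def field_simps)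
qed

text \<open>The Mellin coefficient of the function, normalizing factor included, so that appending a
  pair of parameters just multiplies it by one binomial.\<close>

definition hyp_coeff ::
    "('a::{field,finite} \<Rightarrow> complex) \<Rightarrow> ('a \<Rightarrow> complex) list \<Rightarrow> ('a \<Rightarrow> complex) list
      \<Rightarrow> ('a \<Rightarrow> complex) \<Rightarrow> complex" where
  "hyp_coeff A0 As Bs \<chi> = of_nat CARD('a) / (of_nat CARD('a) - 1) * char_binom (A0 \<odot> \<chi>) \<chi> *
    (\<Prod>i<length As. char_binom (As ! i \<odot> \<chi>) (Bs ! i \<odot> \<chi>))"

lemma gauss_hyp_eq_hyp_coeff:
  assumes "mult_char A0"
  shows "gauss_hyp A0 As Bs x = (\<Sum>\<chi>\<in>mult_chars. hyp_coeff A0 As Bs \<chi> * \<chi> x)"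
proof (cases "As = []")
  case True
  thus ?thesis
    using gauss_hyp_single[OF assms, of x]
    by (simp add: gauss_hyp_def hyp_coeff_def sum_distrib_left mult_ac)
qed (simp add: gauss_hyp_def hyp_coeff_def sum_distrib_left mult_ac)

lemma hyp_coeff_snoc:
  assumes "length As = length Bs"
  shows "hyp_coeff A0 (As @ [A]) (Bs @ [B]) \<chi> = hyp_coeff A0 As Bs \<chi> * char_binom (A \<odot> \<chi>) (B \<odot> \<chi>)"
  using assms by (simp add: hyp_coeff_def nth_append)

context
  assumes odd: "odd CARD('a::{field,finite})"
begin

text \<open>In the Jacobi sum substitute \<open>s = t / (t - 1)\<close>, an involution away from 1;
  then \<open>s * (s - 1)\<close> is \<open>t\<close> divided by a square.\<close>

lemma char_binom_quad_char:
  fixes \<chi> :: "'a \<Rightarrow> complex"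
  assumes \<chi>: "mult_char \<chi>"
  shows "char_binom (quad_char \<odot> \<chi>) \<chi> = (\<Sum>s\<in>UNIV. \<chi> s * quad_char (s * (s - 1))) / of_nat CARD('a)"
proof -
  have "\<chi> (- 1) * jacobi_sum (quad_char \<odot> \<chi>) (char_inv \<chi>) =
    (\<Sum>t\<in>UNIV. quad_char t * \<chi> (- 1 * t / (1 - t)))"
    unfolding jacobi_sum_def sum_distrib_left char_mult_def char_inv_def
      mult_char_divide[OF \<chi>] mult_char_mult[OF \<chi>]
    by (intro sum.cong refl) (simp add: divide_inverse)
  also have "\<dots> = (\<Sum>t\<in>UNIV - {1}. quad_char t * \<chi> (- 1 * t / (1 - t)))"
    by (intro sum.mono_neutral_right) (auto simp: mult_char_0[OF \<chi>])
  also have "\<dots> = (\<Sum>s\<in>UNIV - {1}. \<chi> s * quad_char (s * (s - 1)))"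
  proof (intro sum.reindex_bij_witness[of _ "\<lambda>s. s / (s - 1)" "\<lambda>t. t / (t - 1)"])
    fix t :: 'a assume t: "t \<in> UNIV - {1}"
    have "t / (t - 1) * (t / (t - 1) - 1) = t * (inverse (t - 1))\<^sup>2"
      using t by (simp add: field_simps power2_eq_square)
    moreover have "- 1 * t / (1 - t) = t / (t - 1)"
      using t by (simp add: field_simps)
    ultimately show "\<chi> (t / (t - 1)) * quad_char (t / (t - 1) * (t / (t - 1) - 1)) =
      quad_char t * \<chi> (- 1 * t / (1 - t))"
      using t quad_char_mult_square[OF odd, of "inverse (t - 1)" t] by simp
  qed (auto simp: field_simps)
  also have "\<dots> = (\<Sum>s\<in>UNIV. \<chi> s * quad_char (s * (s - 1)))"
    by (intro sum.mono_neutral_left) auto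
  finally show ?thesis by (simp add: char_binom_def)
qed

text \<open>Inverting the variable brings the binomial into the shape that
  \<open>sum_mult_chars_product\<close> expects.\<close>

lemma char_binom_quad_char_inv:
  fixes \<chi> :: "'a \<Rightarrow> complex"
  assumes \<chi>: "mult_char \<chi>"
  shows "char_binom (quad_char \<odot> \<chi>) \<chi> = (\<Sum>u\<in>UNIV. char_inv \<chi> u * quad_char (1 - u)) / of_nat CARD('a)"
proof -
  have "(\<Sum>s\<in>UNIV. \<chi> s * quad_char (s * (s - 1))) = (\<Sum>u\<in>UNIV. char_inv \<chi> u * quad_char (1 - u))"
  proof (intro sum.reindex_bij_witness[of _ inverse inverse])
    fix s :: 'a
    show "char_inv \<chi> (inverse s) * quad_char (1 - inverse s) = \<chi> s * quad_char (s * (s - 1))"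
    proof (cases "s = 0")
      case False
      hence "s * (s - 1) = (1 - inverse s) * s\<^sup>2" by (simp add: field_simps power2_eq_square)
      thus ?thesis using False quad_char_mult_square[OF odd] by (simp add: char_inv_eq[OF \<chi>])
    qed (simp add: char_inv_eq[OF \<chi>] mult_char_0[OF \<chi>])
  qed auto
  thus ?thesis using char_binom_quad_char[OF \<chi>] by simp
qed

text \<open>The identity \<open>(1 - u) * (1 - z / u) = - u * (u - 1) * (u - z) / u^2\<close> makes
  the Legendre sum a multiplicative convolution.\<close>

lemma legendre_sum_convolution:
  fixes z :: 'a
  assumes z: "z \<noteq> 0"
  shows "(\<Sum>u\<in>UNIV - {0}. quad_char (1 - u) * quad_char (1 - z / u)) = quad_char (- 1 :: 'a) * legendre_sum z"
proof -
  have "(\<Sum>u\<in>UNIV - {0}. quad_char (1 - u) * quad_char (1 - z / u)) =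
    (\<Sum>u\<in>UNIV - {0}. quad_char (- 1 :: 'a) * quad_char (u * (u - 1) * (u - z)))"
  proof (intro sum.cong refl)
    fix u :: 'a assume u: "u \<in> UNIV - {0}"
    hence eq: "(1 - u) * (1 - z / u) = - 1 * (u * (u - 1) * (u - z)) * (inverse u)\<^sup>2"
      by (simp add: field_simps power2_eq_square)
    have "quad_char ((1 - u) * (1 - z / u)) = quad_char (- 1 * (u * (u - 1) * (u - z)))"
      unfolding eq by (rule quad_char_mult_square[OF odd]) (use u in simp)
    thus "quad_char (1 - u) * quad_char (1 - z / u) = quad_char (- 1 :: 'a) * quad_char (u * (u - 1) * (u - z))"
      by (simp only: quad_char_mult[OF odd])
  qed
  also have "\<dots> = (\<Sum>u\<in>UNIV. quad_char (- 1 :: 'a) * quad_char (u * (u - 1) * (u - z)))"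
    by (intro sum.mono_neutral_left) auto
  finally show ?thesis by (simp add: legendre_sum_def sum_distrib_left)
qed

lemma gauss_hyp_quad_char:
  fixes z :: 'a
  assumes z: "z \<noteq> 0"
  shows "gauss_hyp quad_char [quad_char] [triv_char] z = quad_char (- 1 :: 'a) / of_nat CARD('a) * legendre_sum z"
proof -
  define q :: complex where "q = of_nat CARD('a)"
  have q: "q \<noteq> 0" "q - 1 \<noteq> 0"
    using card_field_ge_2[where 'a='a] by (auto simp: q_def)
  have "gauss_hyp quad_char [quad_char] [triv_char] z = q / (q - 1) * (\<Sum>\<chi>\<in>mult_chars.
      (\<Sum>u\<in>UNIV. char_inv \<chi> u * quad_char (1 - u)) * (\<Sum>u\<in>UNIV. char_inv \<chi> u * quad_char (1 - u)) * \<chi> z) / q\<^sup>2"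
    unfolding gauss_hyp_def times_divide_eq_right[symmetric] sum_divide_distrib
    by (auto intro!: sum.cong arg_cong2[where f = "(*)"]
       simp: q_def mult_chars_def char_mult_triv_left char_binom_quad_char_inv power2_eq_square)
  also have "\<dots> = q / (q - 1) * ((q - 1) * (\<Sum>u\<in>UNIV - {0}. quad_char (1 - u) * quad_char (1 - z / u))) / q\<^sup>2"
    unfolding sum_mult_chars_product[OF z] q_def ..
  also have "\<dots> = quad_char (- 1 :: 'a) / q * legendre_sum z"
    unfolding legendre_sum_convolution[OF z] using q by (simp add: field_simps power2_eq_square)
  finally show ?thesis by (simp add: q_def)
qed

text \<open>The square is a double sum over \<open>s\<close> and \<open>t\<close>; collecting the
  terms with \<open>s * t = w\<close> produces the convolution that equals \<open>2F1\<close> at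
  \<open>w\<close> up to the factor \<open>q\<close>.\<close>

lemma char_binom_quad_char_squared:
  fixes \<chi> :: "'a \<Rightarrow> complex"
  assumes \<chi>: "mult_char \<chi>"
  shows "(char_binom (quad_char \<odot> \<chi>) \<chi>)\<^sup>2 = (\<Sum>w\<in>UNIV. quad_char w * \<chi> w *
    gauss_hyp quad_char [quad_char] [triv_char] w) / of_nat CARD('a)"
proof -
  define q :: complex where "q = of_nat CARD('a)"
  have q: "q \<noteq> 0"
    using card_field_ge_2[where 'a='a] by (auto simp: q_def)
  define k where "k s = \<chi> s * quad_char (s * (s - 1))" for s
  have "(\<Sum>s\<in>UNIV. k s)\<^sup>2 = (\<Sum>s\<in>UNIV. \<Sum>t\<in>UNIV. k s * k t)"
    unfolding power2_eq_square sum_product ..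
  also have "\<dots> = (\<Sum>s\<in>UNIV - {0}. \<Sum>t\<in>UNIV - {0}. k s * k t)"
    by (intro sum.mono_neutral_cong_right) (auto simp: k_def intro!: sum.mono_neutral_right)
  also have "\<dots> = (\<Sum>s\<in>UNIV - {0}. \<Sum>w\<in>UNIV - {0}. quad_char w * \<chi> w * (quad_char (1 - s) * quad_char (1 - w / s)))"
  proof (rule sum.cong[OF refl])
    fix s :: 'a assume s: "s \<in> UNIV - {0}"
    show "(\<Sum>t\<in>UNIV - {0}. k s * k t) =
      (\<Sum>w\<in>UNIV - {0}. quad_char w * \<chi> w * (quad_char (1 - s) * quad_char (1 - w / s)))"
    proof (intro sum.reindex_bij_witness[of _ "\<lambda>w. w / s" "\<lambda>t. s * t"])
      fix t :: 'a
      have "quad_char (1 - s) * quad_char (1 - t) = quad_char ((s - 1) * (t - 1))"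
        unfolding quad_char_mult[OF odd, symmetric] by (simp add: algebra_simps)
      thus "quad_char (s * t) * \<chi> (s * t) * (quad_char (1 - s) * quad_char (1 - s * t / s)) = k s * k t"
        using s by (simp add: k_def quad_char_mult[OF odd] mult_char_mult[OF \<chi>] mult_ac)
    qed (use s in auto)
  qed
  also have "\<dots> = (\<Sum>w\<in>UNIV - {0}. quad_char w * \<chi> w * (\<Sum>s\<in>UNIV - {0}. quad_char (1 - s) * quad_char (1 - w / s)))"
    by (subst sum.swap) (simp add: sum_distrib_left)
  also have "\<dots> = (\<Sum>w\<in>UNIV - {0}. q * (quad_char w * \<chi> w * gauss_hyp quad_char [quad_char] [triv_char] w))"
    using q by (intro sum.cong refl) (simp add: legendre_sum_convolution gauss_hyp_quad_char q_def)
  also have "\<dots> = (\<Sum>w\<in>UNIV. q * (quad_char w * \<chi> w * gauss_hyp quad_char [quad_char] [triv_char] w))"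
    by (intro sum.mono_neutral_left) auto
  finally show ?thesis
    using q unfolding char_binom_quad_char[OF \<chi>] k_def[symmetric]
    by (simp add: q_def[symmetric] power_divide power2_eq_square flip: sum_distrib_left)
qed

end

section \<open>Gauss sums and the Appell series\<close>

context
  fixes \<zeta> :: complex
  assumes \<zeta>: "primitive_root_of_unity CARD('p::prime_card) \<zeta>"
begin

lemma add_char_0: "add_char \<zeta> (0 :: 'p mod_ring) = 1"
  by (simp add: add_char_def)

text \<open>Representatives add only modulo \<open>q\<close>, which is harmless since
  \<open>\<zeta> ^ q = 1\<close>.\<close>

lemma add_char_add: "add_char \<zeta> (a + b :: 'p mod_ring) = add_char \<zeta> a * add_char \<zeta> b"
proof -
  define q where "q = int CARD('p)"
  have \<zeta>q: "\<zeta> powi q = 1" using \<zeta> by (simp add: q_def primitive_root_of_unity_def)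
  have \<zeta>0: "\<zeta> \<noteq> 0" using \<zeta> by (auto simp: primitive_root_of_unity_def power_0_left)
  have "\<zeta> powi k = \<zeta> powi (k mod q)" for k
  proof -
    have "\<zeta> powi k = \<zeta> powi (q * (k div q) + k mod q)" by simp
    also have "\<dots> = (\<zeta> powi q) powi (k div q) * \<zeta> powi (k mod q)"
      using \<zeta>0 by (simp only: power_int_add power_int_mult simp_thms)
    finally show ?thesis by (simp add: \<zeta>q)
  qed
  from this[of "to_int_mod_ring a + to_int_mod_ring b"] show ?thesis
    using \<zeta>0 by (simp add: add_char_def to_int_mod_ring_add power_int_add q_def)
qed

text \<open>For nonzero \<open>b\<close>, shifting \<open>a\<close> by \<open>1 / b\<close>
  multiplies the sum by \<zeta>, which differs from 1.\<close>

lemma sum_add_char_mult: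
  "(\<Sum>a\<in>UNIV. add_char \<zeta> (a * b :: 'p mod_ring)) = (if b = 0 then of_nat CARD('p) else 0)"
proof (cases "b = 0")
  case False
  have q: "CARD('p) > 1" by (rule nontriv)
  have "add_char \<zeta> (1 :: 'p mod_ring) = \<zeta>" by (simp add: add_char_def)
  moreover have "\<zeta> \<noteq> 1" using \<zeta> q unfolding primitive_root_of_unity_def
    by (metis zero_less_one power_one_right)
  moreover have "(\<Sum>a\<in>UNIV. add_char \<zeta> (a * b)) = (\<Sum>a\<in>UNIV. add_char \<zeta> (a * b) * add_char \<zeta> (1 :: 'p mod_ring))"
  proof (intro sum.reindex_bij_witness[of _ "\<lambda>a. a + 1 / b" "\<lambda>a. a - 1 / b"])
    fix a :: "'p mod_ring"
    have "(a - 1 / b) * b + 1 = a * b" using False by (simp add: field_simps)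
    thus "add_char \<zeta> ((a - 1 / b) * b) * add_char \<zeta> (1 :: 'p mod_ring) = add_char \<zeta> (a * b)"
      by (metis add_char_add)
  qed auto
  ultimately show ?thesis using False by (simp flip: sum_distrib_right)
qed (simp add: add_char_0)

lemma gauss_sum_triv_char: "gauss_sum \<zeta> (triv_char :: 'p mod_ring \<Rightarrow> complex) = - 1"
proof -
  have "gauss_sum \<zeta> (triv_char :: 'p mod_ring \<Rightarrow> complex) =
      (\<Sum>a\<in>UNIV - {0}. add_char \<zeta> (a * 1 :: 'p mod_ring))"
    unfolding gauss_sum_def by (intro sum.mono_neutral_cong_right) (auto simp: triv_char_def)
  also have "\<dots> = (\<Sum>a\<in>UNIV. add_char \<zeta> (a * 1 :: 'p mod_ring)) - 1"
    by (simp add: sum_diff1 add_char_0)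
  finally show ?thesis unfolding sum_add_char_mult by simp
qed

section \<open>Quadratic Gauss sums and the elimination of Gauss sums from \<open>F4\<close>\<close>

context
  assumes odd: "odd CARD('p)"
begin

lemma mod_ring_odd: "odd CARD('p mod_ring)"
  using odd by simp

lemma sum_quad_char_add_char:
  "(\<Sum>c\<in>UNIV. quad_char c * add_char \<zeta> (c * b :: 'p mod_ring)) = quad_char b * gauss_sum \<zeta> (quad_char :: 'p mod_ring \<Rightarrow> complex)"
proof (cases "b = 0")
  case False
  have "(\<Sum>c\<in>UNIV. quad_char c * add_char \<zeta> (c * b)) = (\<Sum>c\<in>UNIV. quad_char b * (quad_char c * add_char \<zeta> (c :: 'p mod_ring)))"
    using False
    by (intro sum.reindex_bij_witness[of _ "\<lambda>c. c / b" "\<lambda>c. c * b"])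
       (auto simp: quad_char_mult[OF mod_ring_odd] quad_char_square_self mult_ac)
  thus ?thesis by (simp add: gauss_sum_def sum_distrib_left)
qed (simp add: add_char_0 sum_quad_char[OF mod_ring_odd])

text \<open>It serves to show that the quadratic Gauss sum, which occurs in the denominator of
  \<open>F4\<close>, is nonzero.\<close>

lemma gauss_sum_quad_char_squared:
  "(gauss_sum \<zeta> (quad_char :: 'p mod_ring \<Rightarrow> complex))\<^sup>2 = quad_char (- 1 :: 'p mod_ring) * of_nat CARD('p)"
proof -
  let ?\<phi> = "quad_char :: 'p mod_ring \<Rightarrow> complex"
  have "(gauss_sum \<zeta> ?\<phi>)\<^sup>2 = (\<Sum>b\<in>UNIV. (?\<phi> b * gauss_sum \<zeta> ?\<phi>) * add_char \<zeta> b)"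
    by (simp add: gauss_sum_def power2_eq_square sum_distrib_left mult_ac)
  also have "\<dots> = (\<Sum>b\<in>UNIV. \<Sum>c\<in>UNIV. ?\<phi> c * add_char \<zeta> (b * (c + 1)))"
    unfolding sum_quad_char_add_char[symmetric] sum_distrib_right
    by (intro sum.cong refl) (simp add: distrib_left add_char_add mult_ac)
  also have "\<dots> = (\<Sum>c\<in>UNIV. ?\<phi> c * (\<Sum>b\<in>UNIV. add_char \<zeta> (b * (c + 1))))"
    by (subst sum.swap) (simp add: sum_distrib_left)
  also have "\<dots> = (\<Sum>c\<in>UNIV. if c = - 1 then ?\<phi> c * of_nat CARD('p) else 0)"
    unfolding sum_add_char_mult by (intro sum.cong refl) (auto simp: eq_neg_iff_add_eq_0)
  finally show ?thesis by simp
qed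

text \<open>Each value \<open>\<chi> c\<close> of the first Gauss sum is absorbed by rescaling the
  variable of another one. The additive characters merge at \<open>c * (1 + u + v)\<close>, and the
  sum over \<open>c\<close> is again a quadratic Gauss sum.\<close>

lemma gauss_sum_product:
  fixes \<chi> \<psi> :: "'p mod_ring \<Rightarrow> complex"
  assumes \<chi>: "mult_char \<chi>" and \<psi>: "mult_char \<psi>"
  shows "gauss_sum \<zeta> (quad_char \<odot> \<chi> \<odot> \<psi>) * gauss_sum \<zeta> (char_inv \<chi>) * gauss_sum \<zeta> (char_inv \<psi>) =
    gauss_sum \<zeta> (quad_char :: 'p mod_ring \<Rightarrow> complex) *
    (\<Sum>u\<in>UNIV. char_inv \<chi> u * (\<Sum>v\<in>UNIV. char_inv \<psi> v * quad_char (1 + u + v)))"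
proof -
  have scale: "\<chi> c * gauss_sum \<zeta> (char_inv \<chi>) = (\<Sum>u\<in>UNIV. char_inv \<chi> u * add_char \<zeta> (c * u))"
    if "mult_char \<chi>" "c \<noteq> 0" for \<chi> :: "'p mod_ring \<Rightarrow> complex" and c
  proof -
    have "gauss_sum \<zeta> (char_inv \<chi>) = (\<Sum>u\<in>UNIV. char_inv \<chi> (c * u) * add_char \<zeta> (c * u))"
      unfolding gauss_sum_def using that
      by (intro sum.reindex_bij_witness[of _ "\<lambda>u. c * u" "\<lambda>u. u / c"]) auto
    moreover have "\<chi> c \<noteq> 0" using that by (simp add: mult_char_eq_0_iff)
    ultimately show ?thesis using that
      by (simp add: sum_distrib_left char_inv_def mult_char_mult flip: mult.assoc)
  qed
  have "gauss_sum \<zeta> (quad_char \<odot> \<chi> \<odot> \<psi>) * gauss_sum \<zeta> (char_inv \<chi>) * gauss_sum \<zeta> (char_inv \<psi>) =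
    (\<Sum>c\<in>UNIV. quad_char c * add_char \<zeta> c * (\<chi> c * gauss_sum \<zeta> (char_inv \<chi>)) * (\<psi> c * gauss_sum \<zeta> (char_inv \<psi>)))"
    unfolding gauss_sum_def[of _ "quad_char \<odot> \<chi> \<odot> \<psi>"] sum_distrib_right
    by (intro sum.cong refl) (simp add: char_mult_def mult_ac)
  also have "\<dots> = (\<Sum>c\<in>UNIV. quad_char c * add_char \<zeta> c *
    (\<Sum>u\<in>UNIV. char_inv \<chi> u * add_char \<zeta> (c * u)) * (\<Sum>v\<in>UNIV. char_inv \<psi> v * add_char \<zeta> (c * v)))"
  proof (rule sum.cong[OF refl])
    fix c :: "'p mod_ring"
    show "quad_char c * add_char \<zeta> c * (\<chi> c * gauss_sum \<zeta> (char_inv \<chi>)) * (\<psi> c * gauss_sum \<zeta> (char_inv \<psi>)) =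
      quad_char c * add_char \<zeta> c *
      (\<Sum>u\<in>UNIV. char_inv \<chi> u * add_char \<zeta> (c * u)) * (\<Sum>v\<in>UNIV. char_inv \<psi> v * add_char \<zeta> (c * v))"
      by (cases "c = 0") (simp_all add: scale[OF \<chi>] scale[OF \<psi>])
  qed
  also have "\<dots> = (\<Sum>c\<in>UNIV. \<Sum>u\<in>UNIV. \<Sum>v\<in>UNIV.
    char_inv \<chi> u * char_inv \<psi> v * (quad_char c * add_char \<zeta> (c * (1 + u + v))))"
  proof (rule sum.cong[OF refl])
    fix c :: "'p mod_ring"
    have "add_char \<zeta> (c * (1 + u + v)) = add_char \<zeta> c * add_char \<zeta> (c * u) * add_char \<zeta> (c * v)" for u v
      by (simp add: distrib_left add_char_add)
    thus "quad_char c * add_char \<zeta> c *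
      (\<Sum>u\<in>UNIV. char_inv \<chi> u * add_char \<zeta> (c * u)) * (\<Sum>v\<in>UNIV. char_inv \<psi> v * add_char \<zeta> (c * v)) =
      (\<Sum>u\<in>UNIV. \<Sum>v\<in>UNIV. char_inv \<chi> u * char_inv \<psi> v * (quad_char c * add_char \<zeta> (c * (1 + u + v))))"
      by (simp add: sum_product sum_distrib_left mult_ac)
  qed
  also have "\<dots> = (\<Sum>u\<in>UNIV. \<Sum>c\<in>UNIV. \<Sum>v\<in>UNIV.
    char_inv \<chi> u * char_inv \<psi> v * (quad_char c * add_char \<zeta> (c * (1 + u + v))))"
    by (rule sum.swap)
  also have "\<dots> = (\<Sum>u\<in>UNIV. \<Sum>v\<in>UNIV. \<Sum>c\<in>UNIV.
    char_inv \<chi> u * char_inv \<psi> v * (quad_char c * add_char \<zeta> (c * (1 + u + v))))"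
    by (rule sum.cong[OF refl], rule sum.swap)
  also have "\<dots> = gauss_sum \<zeta> (quad_char :: 'p mod_ring \<Rightarrow> complex) *
    (\<Sum>u\<in>UNIV. char_inv \<chi> u * (\<Sum>v\<in>UNIV. char_inv \<psi> v * quad_char (1 + u + v)))"
    unfolding sum_distrib_left[symmetric] sum_quad_char_add_char
    by (simp add: sum_distrib_left mult_ac)
  finally show ?thesis .
qed

text \<open>The six Gauss sums in each term form two equal triples as in
  \<open>gauss_sum_product\<close>. The two quadratic Gauss sums this produces cancel against the
  denominator, where the trivial ones contribute \<open>(- 1)^2\<close>.\<close>

lemma appell_F4_quad_char:
  fixes a b :: "'p mod_ring"
  assumes a: "a \<noteq> 0" and b: "b \<noteq> 0"
  shows "appell_F4 \<zeta> quad_char quad_char triv_char triv_char a b =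
    (\<Sum>u\<in>UNIV. \<Sum>v\<in>UNIV. quad_char (u * v * (1 + u + v) * (u * v + a * v + b * u)))"
proof -
  let ?\<phi> = "quad_char :: 'p mod_ring \<Rightarrow> complex"
  define q :: complex where "q = of_nat CARD('p)"
  have q: "q \<noteq> 0" "q - 1 \<noteq> 0"
    using card_field_ge_2[where 'a="'p mod_ring"] by (auto simp: q_def)
  define G where "G = gauss_sum \<zeta> ?\<phi>"
  have G: "G * G \<noteq> 0"
    using gauss_sum_quad_char_squared q
    by (simp add: G_def q_def power2_eq_square quad_char_def)
  define f where "f \<psi> u = (\<Sum>v\<in>UNIV. char_inv \<psi> v * ?\<phi> (1 + u + v))" for \<psi> u
  define T where "T \<chi> \<psi> = (\<Sum>u\<in>UNIV. char_inv \<chi> u * f \<psi> u)" for \<chi> \<psi>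
  have "appell_F4 \<zeta> quad_char quad_char triv_char triv_char a b =
    1 / (q - 1)\<^sup>2 * (\<Sum>\<chi>\<in>mult_chars. \<Sum>\<psi>\<in>mult_chars. T \<chi> \<psi> * T \<chi> \<psi> * \<chi> a * \<psi> b)"
    unfolding appell_F4_def q_def[symmetric]
  proof (intro arg_cong2[where f = "(*)"] refl, rule sum.cong[OF refl], rule sum.cong[OF refl])
    fix \<chi> \<psi> :: "'p mod_ring \<Rightarrow> complex"
    assume "\<chi> \<in> mult_chars" "\<psi> \<in> mult_chars"
    hence c: "mult_char \<chi>" "mult_char \<psi>" by (simp_all add: mult_chars_def)
    have "gauss_sum \<zeta> (quad_char \<odot> \<chi> \<odot> \<psi>) * gauss_sum \<zeta> (quad_char \<odot> \<chi> \<odot> \<psi>) *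
       gauss_sum \<zeta> (char_inv \<chi>) * gauss_sum \<zeta> (char_inv \<psi>) *
       gauss_sum \<zeta> (char_inv \<psi>) * gauss_sum \<zeta> (char_inv \<chi>) =
      (gauss_sum \<zeta> (quad_char \<odot> \<chi> \<odot> \<psi>) * gauss_sum \<zeta> (char_inv \<chi>) * gauss_sum \<zeta> (char_inv \<psi>)) *
      (gauss_sum \<zeta> (quad_char \<odot> \<chi> \<odot> \<psi>) * gauss_sum \<zeta> (char_inv \<chi>) * gauss_sum \<zeta> (char_inv \<psi>))"
      by (simp only: mult_ac)
    also have "\<dots> = (G * G) * (T \<chi> \<psi> * T \<chi> \<psi>)"
      unfolding gauss_sum_product[OF c] T_def f_def G_def by (simp only: mult_ac)
    finally have "gauss_sum \<zeta> (quad_char \<odot> \<chi> \<odot> \<psi>) * gauss_sum \<zeta> (quad_char \<odot> \<chi> \<odot> \<psi>) *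
       gauss_sum \<zeta> (char_inv \<chi>) * gauss_sum \<zeta> (char_inv \<psi>) *
       gauss_sum \<zeta> (char_inv \<psi>) * gauss_sum \<zeta> (char_inv \<chi>) = (G * G) * (T \<chi> \<psi> * T \<chi> \<psi>)" .
    thus "gauss_sum \<zeta> (quad_char \<odot> \<chi> \<odot> \<psi>) * gauss_sum \<zeta> (quad_char \<odot> \<chi> \<odot> \<psi>) *
       gauss_sum \<zeta> (char_inv (triv_char \<odot> \<chi>)) * gauss_sum \<zeta> (char_inv (triv_char \<odot> \<psi>)) *
       gauss_sum \<zeta> (char_inv \<psi>) * gauss_sum \<zeta> (char_inv \<chi>) /
       (gauss_sum \<zeta> ?\<phi> * gauss_sum \<zeta> ?\<phi> * gauss_sum \<zeta> (char_inv (triv_char :: 'p mod_ring \<Rightarrow> complex)) *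
         gauss_sum \<zeta> (char_inv (triv_char :: 'p mod_ring \<Rightarrow> complex)))
       * \<chi> a * \<psi> b = T \<chi> \<psi> * T \<chi> \<psi> * \<chi> a * \<psi> b"
      using G by (simp add: char_mult_triv_left c gauss_sum_triv_char G_def[symmetric])
  qed
  also have "(\<Sum>\<chi>\<in>mult_chars. \<Sum>\<psi>\<in>mult_chars. T \<chi> \<psi> * T \<chi> \<psi> * \<chi> a * \<psi> b) =
    (\<Sum>\<psi>\<in>mult_chars. (\<Sum>\<chi>\<in>mult_chars. T \<chi> \<psi> * T \<chi> \<psi> * \<chi> a) * \<psi> b)"
    by (subst sum.swap) (simp add: sum_distrib_right)
  \<comment> \<open>The sum over \<chi> pairs \<open>u\<close> with \<open>a / u\<close>; the sum
    over \<psi> will pair \<open>v\<close> with \<open>b / v\<close>. Each yields a factor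
    \<open>q - 1\<close>, cancelling the normalization.\<close>
  also have "\<dots> = (\<Sum>\<psi>\<in>mult_chars. (q - 1) * (\<Sum>u\<in>UNIV - {0}. f \<psi> u * f \<psi> (a / u)) * \<psi> b)"
    unfolding T_def sum_mult_chars_product[OF a] q_def by simp
  also have "\<dots> = (q - 1) * (\<Sum>u\<in>UNIV - {0}. \<Sum>\<psi>\<in>mult_chars. f \<psi> u * f \<psi> (a / u) * \<psi> b)"
    unfolding sum_distrib_left sum_distrib_right by (subst sum.swap) (simp add: mult_ac)
  also have "\<dots> = (q - 1) * (\<Sum>u\<in>UNIV - {0}. (q - 1) *
      (\<Sum>v\<in>UNIV - {0}. ?\<phi> (1 + u + v) * ?\<phi> (1 + a / u + b / v)))"
    unfolding f_def sum_mult_chars_product[OF b] q_def by simp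
  also have "\<dots> = (q - 1)\<^sup>2 * (\<Sum>u\<in>UNIV - {0}. \<Sum>v\<in>UNIV - {0}. ?\<phi> (1 + u + v) * ?\<phi> (1 + a / u + b / v))"
    by (simp add: power2_eq_square sum_distrib_left mult_ac)
  also have "(\<Sum>u\<in>UNIV - {0}. \<Sum>v\<in>UNIV - {0}. ?\<phi> (1 + u + v) * ?\<phi> (1 + a / u + b / v)) =
    (\<Sum>u\<in>UNIV - {0}. \<Sum>v\<in>UNIV - {0}. ?\<phi> (u * v * (1 + u + v) * (u * v + a * v + b * u)))"
  proof (rule sum.cong[OF refl], rule sum.cong[OF refl])
    fix u v :: "'p mod_ring" assume uv: "u \<in> UNIV - {0}" "v \<in> UNIV - {0}"
    have conic: "(1 + a / u + b / v) * (u * v) = u * v + a * v + b * u"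
      using uv by (simp add: distrib_right)
    have eq: "u * v * (1 + u + v) * (u * v + a * v + b * u) =
      (1 + u + v) * (1 + a / u + b / v) * (u * v)\<^sup>2"
      unfolding conic[symmetric] by (simp only: power2_eq_square mult_ac)
    have "?\<phi> (u * v * (1 + u + v) * (u * v + a * v + b * u)) = ?\<phi> ((1 + u + v) * (1 + a / u + b / v))"
      unfolding eq by (rule quad_char_mult_square[OF mod_ring_odd]) (use uv in simp)
    thus "?\<phi> (1 + u + v) * ?\<phi> (1 + a / u + b / v) = ?\<phi> (u * v * (1 + u + v) * (u * v + a * v + b * u))"
      by (simp only: quad_char_mult[OF mod_ring_odd])
  qed
  also have "\<dots> = (\<Sum>u\<in>UNIV. \<Sum>v\<in>UNIV. ?\<phi> (u * v * (1 + u + v) * (u * v + a * v + b * u)))"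
    by (intro sum.mono_neutral_cong_left) (auto intro!: sum.mono_neutral_left)
  finally show ?thesis using q by simp
qed

text \<open>Each factor is a Legendre sum times \<open>\<phi>(-1) / q\<close>, and the signs
  multiply to 1; the correction term of \<open>sum_quad_char_surface\<close> changes sides.\<close>

lemma gauss_hyp_quad_char_product:
  fixes z w :: "'p mod_ring"
  assumes z: "z \<noteq> 0" "z \<noteq> 1" and w: "w \<noteq> 0" "w \<noteq> 1"
  shows "gauss_hyp quad_char [quad_char] [triv_char] z * gauss_hyp quad_char [quad_char] [triv_char] w =
    appell_F4 \<zeta> quad_char quad_char triv_char triv_char (z * (1 - w)) (w * (1 - z)) / (of_nat CARD('p))\<^sup>2
    + (if w = 1 - z then quad_char (- 1 :: 'p mod_ring) / of_nat CARD('p) else 0)"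
proof -
  define q :: complex where "q = of_nat CARD('p)"
  have q: "q \<noteq> 0" by (simp add: q_def)
  define e where "e = quad_char (- 1 :: 'p mod_ring)"
  have e: "e * e = 1" unfolding e_def by (rule quad_char_square_self) simp
  have card: "of_nat CARD('p mod_ring) = q" by (simp add: q_def)
  define L where "L = legendre_sum z * legendre_sum w"
  have "appell_F4 \<zeta> quad_char quad_char triv_char triv_char (z * (1 - w)) (w * (1 - z)) =
    L - (if w = 1 - z then q * e else 0)"
    using sum_quad_char_surface[OF mod_ring_odd z w] appell_F4_quad_char[of "z * (1 - w)" "w * (1 - z)"] z w
    by (simp add: q_def e_def L_def)
  moreover have "gauss_hyp quad_char [quad_char] [triv_char] z * gauss_hyp quad_char [quad_char] [triv_char] w =
    (e * e) * L / q\<^sup>2"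
    unfolding gauss_hyp_quad_char[OF mod_ring_odd z(1)] gauss_hyp_quad_char[OF mod_ring_odd w(1)] card e_def L_def
    by (simp add: power2_eq_square)
  moreover have "L / q\<^sup>2 = (L - (if w = 1 - z then q * e else 0)) / q\<^sup>2 + (if w = 1 - z then e / q else 0)"
    using q by (simp add: diff_divide_distrib power2_eq_square)
  ultimately show ?thesis
    by (simp only: q_def[symmetric] e_def[symmetric] e mult_1_left)
qed

end

end

theorem theorem3p2:
  fixes n q :: nat
    and \<zeta> :: complex
    and A0 :: "'p::prime_card mod_ring \<Rightarrow> complex"
    and As Bs :: "('p mod_ring \<Rightarrow> complex) list"
    and x z :: "'p mod_ring"
  assumes "q = CARD('p)" and "odd q"
    and "n \<ge> 2"
    and "primitive_root_of_unity q \<zeta>"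
    and "mult_char A0"
    and "length As = n - 2" and "\<forall>A\<in>set As. mult_char A"
    and "length Bs = n - 2" and "\<forall>B\<in>set Bs. mult_char B"
    and "x \<notin> {0, 1}" and "z \<notin> {0, 1}"
  shows
    "gauss_hyp quad_char [quad_char] [triv_char] z *
       gauss_hyp A0 (As @ [quad_char, quad_char]) (Bs @ [triv_char, triv_char]) x
     = quad_char (- 1 :: 'p mod_ring) / (of_nat q)\<^sup>2 * quad_char (1 - z) *
         gauss_hyp A0 As Bs ((1 - z) * x)
       + 1 / of_nat q * gauss_hyp A0 As Bs x *
         gauss_hyp quad_char [quad_char] [triv_char] (1 :: 'p mod_ring) *
         gauss_hyp quad_char [quad_char] [triv_char] z
       + 1 / (of_nat q) ^ 3 *
         (\<Sum>w\<in>UNIV - {1}. quad_char w * gauss_hyp A0 As Bs (w * x) *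
            appell_F4 \<zeta> quad_char quad_char triv_char triv_char (z * (1 - w)) (w * (1 - z)))"
proof -
  have odd: "odd CARD('p)" and odd': "odd CARD('p mod_ring)" using assms by simp_all
  have \<zeta>: "primitive_root_of_unity CARD('p) \<zeta>" using assms by simp
  have z: "z \<noteq> 0" "z \<noteq> 1" using assms by auto
  define Q :: complex where "Q = of_nat q"
  have Q: "Q \<noteq> 0" using assms by (simp add: Q_def)
  define P where "P w = gauss_hyp quad_char [quad_char] [triv_char] w" for w :: "'p mod_ring"
  define F where "F w = gauss_hyp A0 As Bs (w * x)" for w
  define H where "H w = appell_F4 \<zeta> quad_char quad_char triv_char triv_char (z * (1 - w)) (w * (1 - z))" for w
  define e where "e = quad_char (- 1 :: 'p mod_ring)"
  let ?\<phi> = "quad_char :: 'p mod_ring \<Rightarrow> complex"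
  have "gauss_hyp A0 (As @ [quad_char, quad_char]) (Bs @ [triv_char, triv_char]) x =
    (\<Sum>\<chi>\<in>mult_chars. hyp_coeff A0 As Bs \<chi> * (char_binom (?\<phi> \<odot> \<chi>) \<chi>)\<^sup>2 * \<chi> x)"
  proof -
    have "hyp_coeff A0 ((As @ [quad_char]) @ [quad_char]) ((Bs @ [triv_char]) @ [triv_char]) \<chi> =
      hyp_coeff A0 As Bs \<chi> * (char_binom (?\<phi> \<odot> \<chi>) \<chi>)\<^sup>2" if "\<chi> \<in> mult_chars" for \<chi>
      using assms that by (subst hyp_coeff_snoc, simp, subst hyp_coeff_snoc)
        (simp_all add: mult_chars_def char_mult_triv_left power2_eq_square)
    thus ?thesis using assms by (simp add: gauss_hyp_eq_hyp_coeff)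
  qed
  \<comment> \<open>Expanding the squared binomial over \<open>w\<close> merges
    \<open>\<chi> w\<close> with \<open>\<chi> x\<close>, so that the sum over \<chi> becomes the
    shorter function at \<open>w * x\<close>.\<close>
  also have "\<dots> = (\<Sum>\<chi>\<in>mult_chars. \<Sum>w\<in>UNIV. ?\<phi> w * P w / Q * (hyp_coeff A0 As Bs \<chi> * \<chi> (w * x)))"
  proof (rule sum.cong[OF refl])
    fix \<chi> :: "'p mod_ring \<Rightarrow> complex" assume "\<chi> \<in> mult_chars"
    hence \<chi>: "mult_char \<chi>" by (simp add: mult_chars_def)
    show "hyp_coeff A0 As Bs \<chi> * (char_binom (?\<phi> \<odot> \<chi>) \<chi>)\<^sup>2 * \<chi> x =
      (\<Sum>w\<in>UNIV. ?\<phi> w * P w / Q * (hyp_coeff A0 As Bs \<chi> * \<chi> (w * x)))"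
      using assms(1) unfolding char_binom_quad_char_squared[OF odd' \<chi>]
      by (simp add: sum_distrib_left sum_distrib_right sum_divide_distrib mult_char_mult[OF \<chi>] P_def Q_def mult_ac)
  qed
  also have "\<dots> = (\<Sum>w\<in>UNIV. ?\<phi> w * P w / Q * F w)"
    unfolding F_def gauss_hyp_eq_hyp_coeff[OF assms(5)]
    by (subst sum.swap) (simp add: sum_distrib_left)
  finally have "P z * gauss_hyp A0 (As @ [quad_char, quad_char]) (Bs @ [triv_char, triv_char]) x =
    (\<Sum>w\<in>UNIV. ?\<phi> w * F w * (P z * P w) / Q)"
    by (simp add: sum_distrib_left mult_ac)
  \<comment> \<open>The product formula excludes \<open>w = 1\<close>, hence the separate
    summand.\<close>
  also have "\<dots> = ?\<phi> 1 * F 1 * (P z * P 1) / Q + (\<Sum>w\<in>UNIV - {1}. ?\<phi> w * F w * (P z * P w) / Q)"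
    by (rule sum.remove) auto
  also have "(\<Sum>w\<in>UNIV - {1}. ?\<phi> w * F w * (P z * P w) / Q) =
    (\<Sum>w\<in>UNIV - {1}. 1 / Q ^ 3 * (?\<phi> w * F w * H w) + (if w = 1 - z then e / Q\<^sup>2 * ?\<phi> w * F w else 0))"
  proof (rule sum.cong[OF refl])
    fix w :: "'p mod_ring" assume w: "w \<in> UNIV - {1}"
    show "?\<phi> w * F w * (P z * P w) / Q =
      1 / Q ^ 3 * (?\<phi> w * F w * H w) + (if w = 1 - z then e / Q\<^sup>2 * ?\<phi> w * F w else 0)"
    \<comment> \<open>The product formula also excludes \<open>w = 0\<close>, but there the factor
      \<open>?\<phi> w\<close> kills every term.\<close>
    proof (cases "w = 0")
      case False
      have "P z * P w = H w / Q\<^sup>2 + (if w = 1 - z then e / Q else 0)"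
        using gauss_hyp_quad_char_product[OF \<zeta> odd z] w False assms(1)
        by (simp add: P_def H_def Q_def e_def)
      thus ?thesis using Q by (simp add: field_simps power2_eq_square power3_eq_cube)
    qed simp
  qed
  \<comment> \<open>Since \<open>z \<noteq> 0\<close>, the exceptional point \<open>1 - z\<close>
    lies in the range of summation and contributes exactly once.\<close>
  also have "\<dots> = 1 / Q ^ 3 * (\<Sum>w\<in>UNIV - {1}. ?\<phi> w * F w * H w) + e / Q\<^sup>2 * ?\<phi> (1 - z) * F (1 - z)"
    using z by (simp add: sum.distrib sum_distrib_left)
  also have "F 1 = gauss_hyp A0 As Bs x" by (simp add: F_def)
  finally show ?thesis
    by (simp add: P_def F_def H_def Q_def e_def quad_char_1[OF odd'] mult_ac)
qed

end
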